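(* The equivalence relation $E^{ce}_{\max}$ is complete under ternary reducibility $\leq_c^3$ among $\Pi^0_2$ equivalence relations (every $\Pi^0_2$ equivalence relation $R$ on $\omega$ satisfies $R\leq_c^3E^{ce}_{\max}$), but it is not complete under $4$-ary reducibility $\leq_c^4$ among $\Pi^0_2$ equivalence relations.
   Context: $W_e$ is the $e$-th c.e. set. $i\,E^{ce}_{\max}\,j\iff\max(W_i)=\max(W_j)$, with the conventions that the empty set has maximum $-\infty$ and every infinite set has maximum $+\infty$. For equivalence relations $E,F$ on $\omega$ and $n\ge1$, $E\leq_c^nF$ means there is a total computable function mapping each $(x_0,\dots,x_{n-1})\in\omega^n$ to $(y_0,\dots,y_{n-1})\in\omega^n$ with $x_i\,E\,x_j\iff y_i\,F\,y_j$ for all $i<j<n$. A $\Pi^0_2$ equivalence relation is an equivalence relation on $\omega$ that is a $\Pi^0_2$ subset of $\omega\times\omega$. *)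

theory Defs
  imports Main "HOL-Library.Nat_Bijection" "HOL-Library.Extended_Real"
begin

datatype recf =
    Zero
  | Succ
  | Proj nat
  | Comp recf "recf list"
  | Prim recf recf
  | Mu recf

inductive eval :: "recf \<Rightarrow> nat list \<Rightarrow> nat \<Rightarrow> bool" where
  eval_Zero: "eval Zero xs 0"
| eval_Succ: "eval Succ (x # xs) (Suc x)"
| eval_Proj: "n < length xs \<Longrightarrow> eval (Proj n) xs (xs ! n)"
| eval_Comp: "list_all2 (\<lambda>g y. eval g xs y) gs ys \<Longrightarrow> eval f ys z \<Longrightarrow> eval (Comp f gs) xs z"
| eval_Prim0: "eval f xs y \<Longrightarrow> eval (Prim f g) (0 # xs) y"
| eval_PrimS: "eval (Prim f g) (n # xs) y \<Longrightarrow> eval g (n # y # xs) z \<Longrightarrow>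
      eval (Prim f g) (Suc n # xs) z"
| eval_Mu: "eval f (n # xs) 0 \<Longrightarrow> (\<forall>m<n. \<exists>y. eval f (m # xs) y \<and> y > 0) \<Longrightarrow>
      eval (Mu f) xs n"

fun code :: "recf \<Rightarrow> nat" where
  "code Zero = prod_encode (0, 0)"
| "code Succ = prod_encode (1, 0)"
| "code (Proj n) = prod_encode (2, n)"
| "code (Comp f gs) = prod_encode (3, prod_encode (code f, list_encode (map code gs)))"
| "code (Prim f g) = prod_encode (4, prod_encode (code f, code g))"
| "code (Mu f) = prod_encode (5, code f)"

text \<open>The e-th c.e. set: domain of the unary partial function with code e
  (empty if e codes no program).\<close>
definition W :: "nat \<Rightarrow> nat set" where
  "W e = {x. \<exists>p y. code p = e \<and> eval p [x] y}"

definition decidable :: "nat \<Rightarrow> (nat list \<Rightarrow> bool) \<Rightarrow> bool" where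
  "decidable k Q \<longleftrightarrow> (\<exists>p. \<forall>xs. length xs = k \<longrightarrow> eval p xs (if Q xs then 1 else 0))"

definition pi02 :: "(nat \<times> nat) set \<Rightarrow> bool" where
  "pi02 R \<longleftrightarrow> (\<exists>Q. decidable 4 Q \<and> (\<forall>x y. (x, y) \<in> R \<longleftrightarrow> (\<forall>a. \<exists>b. Q [x, y, a, b])))"

definition maxset :: "nat set \<Rightarrow> ereal" where
  "maxset A = (if A = {} then -\<infinity> else if infinite A then \<infinity> else ereal (real (Max A)))"

definition Emax_ce :: "(nat \<times> nat) set" where
  "Emax_ce = {(i, j). maxset (W i) = maxset (W j)}"

definition creduce :: "nat \<Rightarrow> (nat \<times> nat) set \<Rightarrow> (nat \<times> nat) set \<Rightarrow> bool" where
  "creduce n E F \<longleftrightarrow> (\<exists>f :: nat list \<Rightarrow> nat list.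
     (\<forall>i<n. \<exists>p. \<forall>xs. length xs = n \<longrightarrow> eval p xs (f xs ! i)) \<and>
     (\<forall>xs. length xs = n \<longrightarrow> length (f xs) = n \<and>
        (\<forall>i j. i < j \<and> j < n \<longrightarrow> ((xs ! i, xs ! j) \<in> E \<longleftrightarrow> (f xs ! i, f xs ! j) \<in> F))))"

end

theory Submission
  imports Defs
begin

text \<open>For the positive part, let \<open>V\<^sub>i\<close> contain \<open>i\<close> and those \<open>m\<close> congruent to \<open>i\<close> modulo 3 for which
  the \<open>\<Pi>\<^sup>0\<^sub>2\<close> condition for \<open>x\<^sub>i R x\<^sub>j\<close> holds up to \<open>m\<close>, for some \<open>j \<noteq> i\<close>. Then \<open>V\<^sub>i\<close> is infinite iff
  \<open>x\<^sub>i\<close> is related to another entry, finite maxima never agree, and among three elements any two that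
  are each related to another entry are related to each other.

  With four elements there may be two separate classes, whose maxima would both have to be infinite. The
  \<open>e\<close>-th candidate reduction is defeated on \<open>4e, \<dots>, 4e + 3\<close> by relating \<open>4e\<close> to \<open>4e + 1\<close>, and
  \<open>4e + 2\<close> to \<open>4e + 3\<close>, unless the two maxima assigned to the pair are equal and not infinite, which is
  a \<open>\<Sigma>\<^sup>0\<^sub>2\<close> event. That this relation is \<open>\<Pi>\<^sup>0\<^sub>2\<close> needs a decidable approximation of program
  evaluation: the evaluation judgement is presented by finitely many Horn clauses over numbers, and the
  stages of a Horn system are decidable uniformly.\<close>

section \<open>Computable functions and decidable relations\<close>

definition computable :: "nat \<Rightarrow> (nat list \<Rightarrow> nat) \<Rightarrow> bool" where
  "computable k f \<longleftrightarrow> (\<exists>p. \<forall>xs. length xs = k \<longrightarrow> eval p xs (f xs))"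

lemma decidable_iff_computable: "decidable k Q \<longleftrightarrow> computable k (\<lambda>xs. if Q xs then 1 else 0)"
  by (simp add: decidable_def computable_def)

lemma computable_cong:
  assumes "computable k f" "\<And>xs. length xs = k \<Longrightarrow> f xs = g xs"
  shows "computable k g"
  using assms unfolding computable_def by metis

lemma decidable_cong:
  assumes "decidable k P" "\<And>xs. length xs = k \<Longrightarrow> P xs = Q xs"
  shows "decidable k Q"
  using assms unfolding decidable_def by metis

lemma computable_comp:
  assumes "computable (length gs) f" "\<And>g. g \<in> set gs \<Longrightarrow> computable k g"
  shows "computable k (\<lambda>xs. f (map (\<lambda>g. g xs) gs))"
proof -
  obtain p where p: "\<And>ys. length ys = length gs \<Longrightarrow> eval p ys (f ys)"
    using assms(1) unfolding computable_def by auto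
  obtain q where q: "\<And>g xs. g \<in> set gs \<Longrightarrow> length xs = k \<Longrightarrow> eval (q g) xs (g xs)"
    using assms(2) unfolding computable_def by metis
  have "eval (Comp p (map q gs)) xs (f (map (\<lambda>g. g xs) gs))" if "length xs = k" for xs
    by (rule eval_Comp[where ys = "map (\<lambda>g. g xs) gs"])
      (use p q that in \<open>auto simp: list_all2_conv_all_nth\<close>)
  then show ?thesis unfolding computable_def by blast
qed

lemma computable_nth: "i < k \<Longrightarrow> computable k (\<lambda>xs. xs ! i)"
  unfolding computable_def by (metis eval_Proj)

lemma computable_unary:
  assumes "computable 1 (\<lambda>ys. F (ys ! 0))" "computable k f"
  shows "computable k (\<lambda>xs. F (f xs))"
  using computable_comp[of "[f]" "\<lambda>ys. F (ys ! 0)" k] assms by simp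

lemma computable_binary:
  assumes "computable 2 (\<lambda>ys. F (ys ! 0) (ys ! 1))" "computable k f" "computable k g"
  shows "computable k (\<lambda>xs. F (f xs) (g xs))"
  using computable_comp[of "[f, g]" "\<lambda>ys. F (ys ! 0) (ys ! 1)" k] assms
  by (auto simp: numeral_2_eq_2)

lemma computable_Suc: "computable k f \<Longrightarrow> computable k (\<lambda>xs. Suc (f xs))"
proof (rule computable_unary[where F = Suc])
  have "eval Succ xs (Suc (xs ! 0))" if "length xs = 1" for xs
    using that by (cases xs) (auto intro: eval_Succ)
  then show "computable 1 (\<lambda>xs. Suc (xs ! 0))" unfolding computable_def by blast
qed

lemma computable_const: "computable k (\<lambda>xs. c)"
proof (induction c)
  case 0
  then show ?case unfolding computable_def by (blast intro: eval_Zero)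
next
  case (Suc c)
  then show ?case by (rule computable_Suc)
qed

text \<open>\<open>Prim\<close> recurses on the head of its argument list, so the recursion is first
  computed with its length placed in front of the parameters; \<open>n\<close> is then substituted
  by composition with the projections.\<close>

lemma computable_rec_nat:
  assumes b: "computable k b" and h: "computable (Suc (Suc k)) h" and n: "computable k n"
  shows "computable k (\<lambda>xs. rec_nat (b xs) (\<lambda>i a. h (i # a # xs)) (n xs))"
proof -
  obtain p where p: "\<And>xs. length xs = k \<Longrightarrow> eval p xs (b xs)"
    using b unfolding computable_def by auto
  obtain q where q: "\<And>xs. length xs = Suc (Suc k) \<Longrightarrow> eval q xs (h xs)"
    using h unfolding computable_def by auto
  have *: "eval (Prim p q) (m # xs) (rec_nat (b xs) (\<lambda>i a. h (i # a # xs)) m)"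
    if "length xs = k" for m xs
  proof (induction m)
    case 0
    then show ?case using p that by (simp add: eval_Prim0)
  next
    case (Suc m)
    then show ?case using q that by (auto intro: eval_PrimS)
  qed
  define F where "F = (\<lambda>ys. rec_nat (b (tl ys)) (\<lambda>i a. h (i # a # tl ys)) (hd ys))"
  have F: "computable (Suc k) F"
    unfolding computable_def F_def
    by (rule exI[of _ "Prim p q"]) (auto simp: length_Suc_conv *)
  have "computable k (\<lambda>xs. F (map (\<lambda>g. g xs) (n # map (\<lambda>i xs. xs ! i) [0..<k])))"
    by (rule computable_comp) (auto simp: F n intro: computable_nth)
  then show ?thesis
  proof (rule computable_cong)
    fix xs :: "nat list" assume "length xs = k"
    then have "map (\<lambda>g. g xs) (n # map (\<lambda>i xs. xs ! i) [0..<k]) = n xs # xs"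
      using map_nth[of xs] by (simp add: comp_def)
    then show "F (map (\<lambda>g. g xs) (n # map (\<lambda>i xs. xs ! i) [0..<k])) =
        rec_nat (b xs) (\<lambda>i a. h (i # a # xs)) (n xs)"
      by (simp only: F_def list.sel)
  qed
qed

lemma computable_drop:
  assumes "computable k f"
  shows "computable (d + k) (\<lambda>xs. f (drop d xs))"
proof -
  have "computable (d + k) (\<lambda>xs. f (map (\<lambda>g. g xs) (map (\<lambda>i xs. xs ! (d + i)) [0..<k])))"
    by (rule computable_comp) (auto simp: assms intro: computable_nth)
  then show ?thesis
  proof (rule computable_cong)
    fix xs :: "nat list" assume "length xs = d + k"
    then have "map (\<lambda>g. g xs) (map (\<lambda>i xs. xs ! (d + i)) [0..<k]) = drop d xs"
      by (auto simp: list_eq_iff_nth_eq)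
    then show "f (map (\<lambda>g. g xs) (map (\<lambda>i xs. xs ! (d + i)) [0..<k])) = f (drop d xs)"
      by simp
  qed
qed

text \<open>Each bounded quantifier or sum puts its variable at the head of the list and hides it
  from its scope by a \<open>drop 1\<close>. This lemma and the next two read off parameters under
  up to three such binders.\<close>

lemma computable_nth_drop1: "Suc i < k \<Longrightarrow> computable k (\<lambda>xs. drop 1 xs ! i)"
  by (rule computable_cong[OF computable_nth[of "Suc i"]]) auto

lemma computable_nth_drop2: "Suc (Suc i) < k \<Longrightarrow> computable k (\<lambda>xs. drop 1 (drop 1 xs) ! i)"
  by (rule computable_cong[OF computable_nth[of "Suc (Suc i)"]]) auto

lemma computable_nth_drop3: "i + 3 < k \<Longrightarrow> computable k (\<lambda>xs. drop 1 (drop 1 (drop 1 xs)) ! i)"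
  by (rule computable_cong[OF computable_nth[of "i + 3"]]) (auto simp: eval_nat_numeral)

lemmas computable_nths = computable_nth computable_nth_drop1 computable_nth_drop2
  computable_nth_drop3

lemma computable_add:
  "computable k f \<Longrightarrow> computable k g \<Longrightarrow> computable k (\<lambda>xs. f xs + g xs)"
proof (rule computable_binary[where F = "(+)"])
  \<comment> \<open>The step function is written as applied to \<open>i # a # xs\<close>, the form
    produced by \<open>computable_rec_nat\<close>: counter at position 0, accumulator at 1,
    parameters from 2 on. The arithmetic lemmas below follow the same pattern.\<close>
  have "rec_nat b (\<lambda>i a. Suc ((i # a # xs) ! 1)) n = n + b" for b n and xs :: "nat list"
    by (induction n) auto
  then show "computable 2 (\<lambda>ys. ys ! 0 + ys ! 1)"
    using computable_rec_nat[of 2 "\<lambda>ys. ys ! 1" "\<lambda>ys. Suc (ys ! 1)" "\<lambda>ys. ys ! 0"]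
    by (simp add: computable_nth computable_Suc)
qed

lemma computable_mult:
  "computable k f \<Longrightarrow> computable k g \<Longrightarrow> computable k (\<lambda>xs. f xs * g xs)"
proof (rule computable_binary[where F = "(*)"])
  have "rec_nat 0 (\<lambda>i a. (i # a # xs) ! 1 + (i # a # xs) ! 3) n = n * xs ! 1"
    for n and xs :: "nat list"
    by (induction n) auto
  then show "computable 2 (\<lambda>ys. ys ! 0 * ys ! 1)"
    using computable_rec_nat[of 2 "\<lambda>ys. 0" "\<lambda>ys. ys ! 1 + ys ! 3" "\<lambda>ys. ys ! 0"]
    by (simp add: computable_nth computable_add computable_const)
qed

lemma computable_diff:
  "computable k f \<Longrightarrow> computable k g \<Longrightarrow> computable k (\<lambda>xs. f xs - g xs)"
proof (rule computable_binary[where F = "(-)"])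
  \<comment> \<open>The predecessor arises by a recursion that ignores the accumulator and returns
    the counter; iterating it gives truncated subtraction.\<close>
  have pred: "computable k (\<lambda>xs. f xs - 1)" if "computable k f" for k f
  proof (rule computable_unary[where F = "\<lambda>n. n - 1", OF _ that])
    have "rec_nat 0 (\<lambda>i a. (i # a # xs) ! 0) n = n - 1" for n and xs :: "nat list"
      by (cases n) auto
    then show "computable 1 (\<lambda>ys. ys ! 0 - 1)"
      using computable_rec_nat[of 1 "\<lambda>ys. 0" "\<lambda>ys. ys ! 0" "\<lambda>ys. ys ! 0"]
      by (simp add: computable_nth computable_const)
  qed
  have "rec_nat b (\<lambda>i a. (i # a # xs) ! 1 - 1) n = b - n" for b n and xs :: "nat list"
    by (induction n) auto
  then show "computable 2 (\<lambda>ys. ys ! 0 - ys ! 1)"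
    using computable_rec_nat[of 2 "\<lambda>ys. ys ! 0" "\<lambda>ys. ys ! 1 - 1" "\<lambda>ys. ys ! 1"]
    by (simp add: computable_nth pred del: One_nat_def)
qed

text \<open>Source of all bounded search below; the summation index is passed at the head of the
  argument list.\<close>

lemma computable_sum:
  assumes f: "computable (Suc k) (\<lambda>ys. f (ys ! 0) (drop 1 ys))" and n: "computable k n"
  shows "computable k (\<lambda>xs. \<Sum>i<n xs. f i xs)"
proof -
  have "computable (Suc (Suc k)) (\<lambda>ys. ys ! 1 + f (ys ! 0) (drop 2 ys))"
  proof -
    \<comment> \<open>These projections skip position 1, where the recursion keeps the partial
      sum.\<close>
    have "computable (Suc (Suc k))
       (\<lambda>ys. (\<lambda>zs. f (zs ! 0) (drop 1 zs)) (map (\<lambda>g. g ys) (map (\<lambda>i ys. ys ! (if i = 0 then 0 else Suc i)) [0..<Suc k])))"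
      by (rule computable_comp) (use f in \<open>auto intro: computable_nth\<close>)
    then have "computable (Suc (Suc k)) (\<lambda>ys. f (ys ! 0) (drop 2 ys))"
    proof (rule computable_cong)
      fix ys :: "nat list" assume "length ys = Suc (Suc k)"
      then have "map (\<lambda>g. g ys) (map (\<lambda>i ys. ys ! (if i = 0 then 0 else Suc i)) [0..<Suc k]) = ys ! 0 # drop 2 ys"
        by (auto simp: list_eq_iff_nth_eq nth_Cons simp del: upt_Suc split: nat.split)
      then show "(\<lambda>zs. f (zs ! 0) (drop 1 zs)) (map (\<lambda>g. g ys) (map (\<lambda>i ys. ys ! (if i = 0 then 0 else Suc i)) [0..<Suc k])) = f (ys ! 0) (drop 2 ys)"
        by (simp del: upt_Suc)
    qed
    then show ?thesis by (intro computable_add computable_nth) auto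
  qed
  from computable_rec_nat[OF computable_const[of k 0] this n]
  have "computable k (\<lambda>xs. rec_nat 0 (\<lambda>i a. a + f i xs) (n xs))" by simp
  moreover have "rec_nat 0 (\<lambda>i a. a + f i xs) m = (\<Sum>i<m. f i xs)" for m xs
    by (induction m) auto
  ultimately show ?thesis by simp
qed

lemma computable_power_2: "computable k f \<Longrightarrow> computable k (\<lambda>xs. 2 ^ f xs)"
proof (rule computable_unary[where F = "\<lambda>n. 2 ^ n"])
  have "rec_nat 1 (\<lambda>i a. (i # a # xs) ! 1 + (i # a # xs) ! 1) n = 2 ^ n" for n and xs :: "nat list"
    by (induction n) auto
  then show "computable 1 (\<lambda>ys. 2 ^ (ys ! 0))"
    using computable_rec_nat[of 1 "\<lambda>ys. 1" "\<lambda>ys. ys ! 1 + ys ! 1" "\<lambda>ys. ys ! 0"]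
    by (simp add: computable_nth computable_const computable_add)
qed

lemma computable_prod_encode:
  "computable k f \<Longrightarrow> computable k g \<Longrightarrow> computable k (\<lambda>xs. prod_encode (f xs, g xs))"
proof -
  have *: "computable k (\<lambda>xs. triangle (f xs))" if "computable k f" for k f
  proof (rule computable_unary[where F = triangle, OF _ that])
    have "rec_nat 0 (\<lambda>i a. (i # a # xs) ! 1 + Suc ((i # a # xs) ! 0)) n = triangle n"
      for n and xs :: "nat list"
      by (induction n) auto
    then show "computable 1 (\<lambda>ys. triangle (ys ! 0))"
      using computable_rec_nat[of 1 "\<lambda>ys. 0" "\<lambda>ys. ys ! 1 + Suc (ys ! 0)" "\<lambda>ys. ys ! 0"]
      by (simp add: computable_nth computable_const computable_add computable_Suc)
  qed
  assume "computable k f" "computable k g"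
  then show ?thesis
    unfolding prod_encode_def by (auto intro!: computable_add *)
qed

section \<open>Closure properties of decidable relations\<close>

lemma decidable_comp:
  assumes "decidable (length gs) P" "\<And>g. g \<in> set gs \<Longrightarrow> computable k g"
  shows "decidable k (\<lambda>xs. P (map (\<lambda>g. g xs) gs))"
  using computable_comp[of gs "\<lambda>xs. if P xs then 1 else 0" k] assms
  by (simp add: decidable_iff_computable)

lemma decidable_quaternary:
  assumes "decidable 4 P" "computable k f" "computable k g" "computable k h" "computable k l"
  shows "decidable k (\<lambda>xs. P [f xs, g xs, h xs, l xs])"
proof -
  have "decidable (length [f, g, h, l]) P" using assms(1) by (simp add: eval_nat_numeral)
  from decidable_comp[OF this, of k] assms(2-) show ?thesis by auto
qed

lemma decidable_not: "decidable k P \<Longrightarrow> decidable k (\<lambda>xs. \<not> P xs)"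
  unfolding decidable_iff_computable
  by (rule computable_cong[OF computable_diff[OF computable_const[of k 1]]]) auto

lemma decidable_conj: "decidable k P \<Longrightarrow> decidable k Q \<Longrightarrow> decidable k (\<lambda>xs. P xs \<and> Q xs)"
  unfolding decidable_iff_computable
  by (rule computable_cong[OF computable_mult[of k "\<lambda>xs. if P xs then 1 else 0" "\<lambda>xs. if Q xs then 1 else 0"]]) auto

lemma decidable_disj: "decidable k P \<Longrightarrow> decidable k Q \<Longrightarrow> decidable k (\<lambda>xs. P xs \<or> Q xs)"
  using decidable_not[OF decidable_conj[OF decidable_not decidable_not], of k P Q] by simp

text \<open>Truncated subtraction makes \<open>1 - (f - g)\<close> the characteristic
  function.\<close>

lemma decidable_le:
  "computable k f \<Longrightarrow> computable k g \<Longrightarrow> decidable k (\<lambda>xs. f xs \<le> g xs)"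
  unfolding decidable_iff_computable
  by (rule computable_cong[OF computable_diff[OF computable_const[of k 1] computable_diff[of k f g]]]) auto

lemma decidable_eq:
  assumes "computable k f" "computable k g"
  shows "decidable k (\<lambda>xs. f xs = g xs)"
  using decidable_conj[OF decidable_le decidable_le] assms by (simp add: order_eq_iff)

lemma decidable_True: "decidable k (\<lambda>xs. True)"
  using decidable_eq[of k "\<lambda>xs. 0" "\<lambda>xs. 0"] by (simp add: computable_const)

lemma decidable_Ball_set:
  "(\<And>c. c \<in> set cs \<Longrightarrow> decidable k (P c)) \<Longrightarrow> decidable k (\<lambda>xs. \<forall>c\<in>set cs. P c xs)"
  by (induction cs) (auto intro: decidable_True decidable_conj)

lemma decidable_Bex_set:
  assumes "\<And>c. c \<in> set cs \<Longrightarrow> decidable k (P c)"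
  shows "decidable k (\<lambda>xs. \<exists>c\<in>set cs. P c xs)"
  using decidable_not[OF decidable_Ball_set[of cs k "\<lambda>c xs. \<not> P c xs"]] assms
  by (simp add: decidable_not)

text \<open>Counts the witnesses below the bound and compares the count with 1.\<close>

lemma decidable_bex:
  assumes "decidable (Suc k) (\<lambda>ys. P (ys ! 0) (drop 1 ys))" "computable k n"
  shows "decidable k (\<lambda>xs. \<exists>i<n xs. P i xs)"
proof -
  have "computable k (\<lambda>xs. \<Sum>i<n xs. if P i xs then 1 else 0)"
    by (rule computable_sum) (use assms in \<open>auto simp: decidable_iff_computable\<close>)
  then have "decidable k (\<lambda>xs. 1 \<le> (\<Sum>i<n xs. if P i xs then 1 else (0::nat)))"
    by (intro decidable_le computable_const) auto
  moreover have "1 \<le> (\<Sum>i<n xs. if P i xs then 1 else (0::nat)) \<longleftrightarrow> (\<exists>i<n xs. P i xs)" for xs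
    using sum_eq_0_iff[of "{..<n xs}" "\<lambda>i. if P i xs then 1 else (0::nat)"]
    by (auto simp: Suc_le_eq simp del: sum_eq_0_iff split: if_splits)
  ultimately show ?thesis by simp
qed

lemma decidable_ball:
  assumes "decidable (Suc k) (\<lambda>ys. P (ys ! 0) (drop 1 ys))" "computable k n"
  shows "decidable k (\<lambda>xs. \<forall>i<n xs. P i xs)"
  using decidable_not[OF decidable_bex[OF decidable_not[OF assms(1)] assms(2)]] by simp

text \<open>Allows bounded search over all assignments of \<open>m\<close> variables, as needed for
  the instances of a Horn clause.\<close>

lemma decidable_ex_tuple:
  assumes "decidable (m + k) (\<lambda>ys. P (take m ys) (drop m ys))" "computable k n"
  shows "decidable k (\<lambda>xs. \<exists>env. length env = m \<and> (\<forall>v\<in>set env. v < n xs) \<and> P env xs)"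
  using assms
proof (induction m arbitrary: k n P)
  case 0
  then show ?case by simp
next
  case (Suc m)
  \<comment> \<open>The last entry of the tuple becomes the first parameter, which is the position
    that \<open>decidable_bex\<close> quantifies.\<close>
  define P' where "P' env ys = P (env @ [ys ! 0]) (drop 1 ys)" for env ys
  have "decidable (m + Suc k) (\<lambda>ys. P' (take m ys) (drop m ys))"
    by (rule decidable_cong[where P = "\<lambda>ys. P (take (Suc m) ys) (drop (Suc m) ys)"])
      (use Suc.prems(1) in \<open>auto simp: P'_def take_Suc_conv_app_nth\<close>)
  from Suc.IH[OF this, of "\<lambda>ys. n (drop 1 ys)"] computable_drop[OF Suc.prems(2), of 1]
  have "decidable (Suc k) (\<lambda>ys. \<exists>env. length env = m \<and> (\<forall>v\<in>set env. v < n (drop 1 ys)) \<and>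
      P (env @ [ys ! 0]) (drop 1 ys))"
    by (simp add: P'_def)
  from decidable_bex[OF this Suc.prems(2)]
  have "decidable k (\<lambda>xs. \<exists>i<n xs. \<exists>env. length env = m \<and> (\<forall>v\<in>set env. v < n xs) \<and> P (env @ [i]) xs)" .
  then show ?case
  proof (rule decidable_cong)
    fix xs
    show "(\<exists>i<n xs. \<exists>env. length env = m \<and> (\<forall>v\<in>set env. v < n xs) \<and> P (env @ [i]) xs) \<longleftrightarrow>
      (\<exists>env. length env = Suc m \<and> (\<forall>v\<in>set env. v < n xs) \<and> P env xs)" (is "?L \<longleftrightarrow> ?R")
    proof
      assume ?L
      then obtain i env where "i < n xs" "length env = m" "\<forall>v\<in>set env. v < n xs" "P (env @ [i]) xs"
        by blast
      then show ?R by (intro exI[of _ "env @ [i]"]) auto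
    next
      assume ?R
      then obtain env where *: "length env = Suc m" "\<forall>v\<in>set env. v < n xs" "P env xs" by blast
      then obtain e i where "env = e @ [i]" by (metis length_Suc_conv_rev)
      with * show ?L by auto
    qed
  qed
qed

lemma decidable_set_decode:
  assumes "computable k f" "computable k g"
  shows "decidable k (\<lambda>xs. f xs \<in> set_decode (g xs))"
proof -
  \<comment> \<open>Bit \<open>i\<close> of \<open>n\<close> is set iff the quotient of
    \<open>n\<close> by \<open>2 ^ i\<close> is odd; quotient and remainder are found by bounded
    search.\<close>
  have bit: "(\<exists>q<Suc n. \<exists>r<2 ^ i. n = (2 * q + 1) * 2 ^ i + r) \<longleftrightarrow> i \<in> set_decode n" (is "?L \<longleftrightarrow> ?R")
    for i n
  proof
    assume ?L
    then obtain q r where "r < 2 ^ i" "n = (2 * q + 1) * 2 ^ i + r" by blast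
    then have "n div 2 ^ i = 2 * q + 1"
      using div_mult_self3[of "2 ^ i" "2 * q + 1" r] by simp
    then show ?R by (simp add: set_decode_def)
  next
    assume ?R
    then obtain q where q: "n div 2 ^ i = 2 * q + 1" by (auto simp: set_decode_def elim: oddE)
    then have "n = (2 * q + 1) * 2 ^ i + n mod 2 ^ i" by (metis div_mult_mod_eq)
    moreover have "q < Suc n" using q div_le_dividend[of n "2 ^ i"] by linarith
    ultimately show ?L by (metis mod_less_divisor zero_less_numeral zero_less_power)
  qed
  have "decidable 2 (\<lambda>xs. \<exists>q<Suc (xs ! 1). \<exists>r<2 ^ (xs ! 0). xs ! 1 = (2 * q + 1) * 2 ^ (xs ! 0) + r)"
    by (intro decidable_bex decidable_eq computable_add computable_mult computable_power_2
        computable_Suc computable_const computable_nths) auto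
  then have "decidable 2 (\<lambda>xs. xs ! 0 \<in> set_decode (xs ! 1))"
    by (simp only: bit)
  then show ?thesis
    unfolding decidable_iff_computable
    by (rule computable_binary[where F = "\<lambda>x y. if x \<in> set_decode y then 1 else 0"]) (use assms in auto)
qed

lemma computable_if:
  assumes "decidable k P" "computable k f" "computable k g"
  shows "computable k (\<lambda>xs. if P xs then f xs else g xs)"
proof -
  have "computable k (\<lambda>xs. (if P xs then 1 else 0) * f xs + (if \<not> P xs then 1 else 0) * g xs)"
    by (intro computable_add computable_mult assms assms(1)[unfolded decidable_iff_computable]
        decidable_not[OF assms(1), unfolded decidable_iff_computable])
  then show ?thesis by (rule computable_cong) auto
qed

section \<open>Horn clauses\<close>

datatype tm = TVar nat | TZero | TSuc tm | TPair tm tm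

primrec tval :: "nat list \<Rightarrow> tm \<Rightarrow> nat" where
  "tval env (TVar i) = (if i < length env then env ! i else 0)"
| "tval env TZero = 0"
| "tval env (TSuc t) = Suc (tval env t)"
| "tval env (TPair t u) = prod_encode (tval env t, tval env u)"

inductive_set derivable :: "(tm list \<times> tm) list \<Rightarrow> nat \<Rightarrow> nat set" for cs m where
  "(ps, c) \<in> set cs \<Longrightarrow> length env = m \<Longrightarrow> \<forall>p\<in>set ps. tval env p \<in> derivable cs m \<Longrightarrow>
    tval env c \<in> derivable cs m"

definition step :: "(tm list \<times> tm) list \<Rightarrow> nat \<Rightarrow> nat \<Rightarrow> nat set \<Rightarrow> nat \<Rightarrow> bool" where
  "step cs m n S j \<longleftrightarrow> (\<exists>cl\<in>set cs. \<exists>env. length env = m \<and> (\<forall>v\<in>set env. v < n) \<and>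
     tval env (snd cl) = j \<and> (\<forall>p\<in>set (fst cl). tval env p \<in> S))"

text \<open>The bound \<open>n\<close> limits both the variable values and the conclusions, so each
  stage is finite and is found by bounded search. Inclusion of earlier stages is not built in; it
  follows from monotonicity of \<open>step\<close>.\<close>

primrec stage :: "(tm list \<times> tm) list \<Rightarrow> nat \<Rightarrow> nat \<Rightarrow> nat set" where
  "stage cs m 0 = {}"
| "stage cs m (Suc n) = {j. j < n \<and> step cs m n (stage cs m n) j}"

lemma step_mono: "step cs m n S j \<Longrightarrow> n \<le> n' \<Longrightarrow> S \<subseteq> S' \<Longrightarrow> step cs m n' S' j"
  unfolding step_def by (meson in_mono order_less_le_trans)

lemma stage_mono: "n \<le> n' \<Longrightarrow> stage cs m n \<subseteq> stage cs m n'"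
proof (rule lift_Suc_mono_le[of "stage cs m"])
  show "stage cs m n \<subseteq> stage cs m (Suc n)" for n
  proof (induction n)
    case (Suc n)
    show ?case
    proof
      fix j assume "j \<in> stage cs m (Suc n)"
      then show "j \<in> stage cs m (Suc (Suc n))"
        using step_mono[of cs m n "stage cs m n" j "Suc n" "stage cs m (Suc n)"] Suc by auto
    qed
  qed simp
qed

lemma derivable_iff_stage: "j \<in> derivable cs m \<longleftrightarrow> (\<exists>n. j \<in> stage cs m n)"
proof
  assume "j \<in> derivable cs m"
  then show "\<exists>n. j \<in> stage cs m n"
  proof induction
    case (1 ps c env)
    \<comment> \<open>Stages increase, so finitely many derivable premises lie in a common
      one.\<close>
    have "\<exists>n. \<forall>p\<in>set ps'. tval env p \<in> stage cs m n" if "set ps' \<subseteq> set ps" for ps'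
      using that
    proof (induction ps')
      case (Cons p ps')
      then obtain n1 n2 where n: "\<forall>p\<in>set ps'. tval env p \<in> stage cs m n1" "tval env p \<in> stage cs m n2"
        using 1 by fastforce
      have "\<forall>q\<in>set (p # ps'). tval env q \<in> stage cs m (max n1 n2)"
        using n stage_mono[of n1 "max n1 n2" cs m] stage_mono[of n2 "max n1 n2" cs m] by auto
      then show ?case by blast
    qed simp
    then obtain n where n: "\<forall>p\<in>set ps. tval env p \<in> stage cs m n" by blast
    \<comment> \<open>Large enough to exceed the conclusion and every variable value, and to include
      the stage of the premises.\<close>
    define N where "N = Suc (n + tval env c + sum_list env)"
    have "step cs m N (stage cs m N) (tval env c)"
      unfolding step_def
    proof (intro bexI[of _ "(ps, c)"] exI[of _ env] conjI ballI)
      show "v < N" if "v \<in> set env" for v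
        using member_le_sum_list[OF that] by (simp add: N_def)
      show "tval env p \<in> stage cs m N" if "p \<in> set (fst (ps, c))" for p
        using n that stage_mono[of n N cs m] by (auto simp: N_def)
    qed (use 1 in auto)
    then have "tval env c \<in> stage cs m (Suc N)" by (simp add: N_def)
    then show ?case by blast
  qed
next
  have "stage cs m n \<subseteq> derivable cs m" for n
  proof (induction n)
    case (Suc n)
    show ?case
    proof
      fix j assume "j \<in> stage cs m (Suc n)"
      then obtain ps c env where "(ps, c) \<in> set cs" "length env = m" "tval env c = j"
        "\<forall>p\<in>set ps. tval env p \<in> stage cs m n"
        by (auto simp: step_def)
      then show "j \<in> derivable cs m"
        using derivable.intros[of ps c cs env m] Suc by auto
    qed
  qed simp
  then show "\<exists>n. j \<in> stage cs m n \<Longrightarrow> j \<in> derivable cs m" by blast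
qed

lemma computable_tval: "m \<le> k \<Longrightarrow> computable k (\<lambda>xs. tval (take m xs) t)"
proof (induction t)
  case (TVar i)
  show ?case
  proof (cases "i < m")
    case True
    with TVar show ?thesis by (intro computable_cong[OF computable_nth[of i k]]) auto
  next
    case False
    with TVar show ?thesis by (intro computable_cong[OF computable_const[of k 0]]) auto
  qed
qed (auto intro: computable_const computable_Suc computable_prod_encode)

lemma decidable_step:
  assumes "computable k n" "computable k s" "computable k j"
  shows "decidable k (\<lambda>xs. step cs m (n xs) (set_decode (s xs)) (j xs))"
  unfolding step_def
  by (intro decidable_Bex_set decidable_ex_tuple decidable_conj decidable_eq decidable_Ball_set
      decidable_set_decode computable_tval computable_drop assms) auto

lemma finite_stage: "finite (stage cs m n)"
  by (cases n) auto

text \<open>A finite stage is represented by its bit code \<open>set_encode\<close>, so the sequence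
  of stages becomes a primitive recursion on numbers.\<close>

lemma decidable_stage:
  assumes "computable k n" "computable k j"
  shows "decidable k (\<lambda>xs. j xs \<in> stage cs m (n xs))"
proof -
  \<comment> \<open>\<open>G\<close> maps the code of stage \<open>i\<close> to that of stage
    \<open>Suc i\<close>, adding \<open>2 ^ j\<close> for each new member \<open>j\<close>.\<close>
  define G where "G i a = (\<Sum>j<i. if step cs m i (set_decode a) j then 2 ^ j else (0::nat))" for i a
  have G: "set_encode (stage cs m (Suc i)) = G i (set_encode (stage cs m i))" for i
  proof -
    have "stage cs m (Suc i) = {j \<in> {..<i}. step cs m i (stage cs m i) j}" by auto
    then show ?thesis
      by (simp only: G_def set_encode_inverse[OF finite_stage])
        (simp only: set_encode_def sum.inter_filter[OF finite_lessThan])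
  qed
  have *: "rec_nat 0 G i = set_encode (stage cs m i)" for i
    by (induction i) (auto simp: G simp del: stage.simps(2))
  have "computable 3 (\<lambda>ys. G (ys ! 0) (ys ! 1))"
    unfolding G_def
    by (intro computable_sum computable_if decidable_step computable_power_2 computable_const
        computable_nths) auto
  then have "computable 1 (\<lambda>xs. rec_nat 0 (\<lambda>i a. G ((i # a # xs) ! 0) ((i # a # xs) ! 1)) (xs ! 0))"
    by (intro computable_rec_nat computable_const computable_nth) (auto simp: numeral_3_eq_3)
  then have "computable 1 (\<lambda>xs. set_encode (stage cs m (xs ! 0)))"
    by (simp add: *)
  then have "computable k (\<lambda>xs. set_encode (stage cs m (n xs)))"
    by (rule computable_unary) (rule assms)
  then have "decidable k (\<lambda>xs. j xs \<in> set_decode (set_encode (stage cs m (n xs))))"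
    by (intro decidable_set_decode assms)
  then show ?thesis by (simp add: finite_stage)
qed

section \<open>Evaluation as a system of Horn clauses\<close>

inductive_cases eval_ZeroE: "eval Zero xs y"
inductive_cases eval_SuccE: "eval Succ xs y"
inductive_cases eval_ProjE: "eval (Proj n) xs y"
inductive_cases eval_CompE: "eval (Comp f gs) xs y"
inductive_cases eval_Prim0E: "eval (Prim f g) (0 # xs) y"
inductive_cases eval_PrimSE: "eval (Prim f g) (Suc n # xs) y"
inductive_cases eval_MuE: "eval (Mu f) xs y"

text \<open>In the \<open>Mu\<close> case, two different results would give \<open>f\<close> at the
  smaller one both the value 0 and a positive value.\<close>

lemma eval_deterministic: "eval p xs y \<Longrightarrow> eval p xs z \<Longrightarrow> y = z"
proof (induction arbitrary: z rule: eval.induct)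
  case (eval_Comp xs gs ys f w)
  from eval_Comp.prems obtain us where us: "list_all2 (\<lambda>g y. eval g xs y) gs us" "eval f us z"
    by (rule eval_CompE)
  have "ys = us"
    using us(1) eval_Comp.IH(1) by (auto simp: list_all2_conv_all_nth list_eq_iff_nth_eq)
  then show ?case using us(2) eval_Comp.IH(2) by blast
next
  case (eval_Mu f n xs)
  from eval_Mu.prems have z: "eval f (z # xs) 0" "\<forall>m<z. \<exists>y. eval f (m # xs) y \<and> y > 0"
    by (auto elim: eval_MuE)
  show ?case
  proof (cases n z rule: linorder_cases)
    case less
    with z(2) obtain y where "eval f (n # xs) y" "y > 0" by blast
    with eval_Mu.IH(1) show ?thesis by blast
  next
    case greater
    with eval_Mu.IH(2) z(1) show ?thesis by blast
  qed
next
  case (eval_PrimS f g n xs y w)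
  from eval_PrimS.prems obtain u where "eval (Prim f g) (n # xs) u" "eval g (n # u # xs) z"
    by (rule eval_PrimSE)
  with eval_PrimS.IH show ?case by blast
next
  case (eval_Prim0 f xs y g)
  from eval_Prim0.prems have "eval f xs z" by (auto elim: eval_Prim0E)
  with eval_Prim0.IH show ?case by blast
qed (auto elim: eval_ZeroE eval_SuccE eval_ProjE)

lemma code_inject: "code p = code q \<Longrightarrow> p = q"
proof (induction p arbitrary: q)
  case (Comp f gs)
  then obtain h hs where q: "q = Comp h hs" "code f = code h" "map code gs = map code hs"
    by (cases q) (auto simp: list_encode_eq)
  moreover have "gs = hs"
    using q(3) Comp.IH(2) by (intro list.inj_map_strong[of gs hs code code]) auto
  ultimately show ?case using Comp.IH(1) by auto
next
  case Zero
  then show ?case by (cases q) auto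
next
  case Succ
  then show ?case by (cases q) auto
next
  case (Proj n)
  then show ?case by (cases q) auto
next
  case (Prim f g)
  then show ?case by (cases q) auto
next
  case (Mu f)
  then show ?case by (cases q) auto
qed

text \<open>The tag \<open>t\<close> merges all kinds of judgement into one set of numbers, so
  mutual recursion needs no extra machinery. Judgements with fewer arguments are padded with
  0.\<close>

definition judg :: "nat \<Rightarrow> nat \<Rightarrow> nat \<Rightarrow> nat \<Rightarrow> nat" where
  "judg t a b c = prod_encode (t, prod_encode (a, prod_encode (b, c)))"

definition lcons :: "nat \<Rightarrow> nat \<Rightarrow> nat" where
  "lcons x r = Suc (prod_encode (x, r))"

primrec tnum :: "nat \<Rightarrow> tm" where
  "tnum 0 = TZero"
| "tnum (Suc n) = TSuc (tnum n)"

definition tjudg :: "nat \<Rightarrow> tm \<Rightarrow> tm \<Rightarrow> tm \<Rightarrow> tm" where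
  "tjudg t a b c = TPair (tnum t) (TPair a (TPair b c))"

definition tcons :: "tm \<Rightarrow> tm \<Rightarrow> tm" where
  "tcons x r = TSuc (TPair x r)"

text \<open>With programs and argument lists given by their codes, the judgements read:
  \<^item> 0: \<open>a\<close> is a program;
  \<^item> 1: \<open>a\<close> is a list of programs;
  \<^item> 2: entry \<open>a\<close> of the list \<open>b\<close> is \<open>c\<close>;
  \<^item> 3: \<open>a\<close> evaluates to \<open>c\<close> on \<open>b\<close>;
  \<^item> 4: the programs in the list \<open>a\<close> evaluate to the entries of \<open>c\<close> on \<open>b\<close>;
  \<^item> 5: \<open>a\<close> has positive values on \<open>m # b\<close> for all \<open>m < c\<close>;
  \<^item> 6: for \<open>c = (i, x)\<close>, the output of entry \<open>i\<close> of the list \<open>a\<close> on \<open>b\<close> is an index of a c.e. set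
    containing \<open>x\<close>.

  The judgements 0 and 1 are needed because the base case of \<open>Prim f g\<close> does not run \<open>g\<close>, which
  must nevertheless be a program.\<close>

definition eval_clauses :: "(tm list \<times> tm) list" where
  "eval_clauses = (let u = TVar 0; v = TVar 1; w = TVar 2; x = TVar 3; y = TVar 4; z = TVar 5; n = TZero in
    [([], tjudg 0 (TPair n n) n n),
     ([], tjudg 0 (TPair (tnum 1) n) n n),
     ([], tjudg 0 (TPair (tnum 2) u) n n),
     ([tjudg 0 u n n, tjudg 1 v n n], tjudg 0 (TPair (tnum 3) (TPair u v)) n n),
     ([tjudg 0 u n n, tjudg 0 v n n], tjudg 0 (TPair (tnum 4) (TPair u v)) n n),
     ([tjudg 0 u n n], tjudg 0 (TPair (tnum 5) u) n n),
     ([], tjudg 1 n n n),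
     ([tjudg 0 u n n, tjudg 1 v n n], tjudg 1 (tcons u v) n n),
     ([], tjudg 2 n (tcons u v) u),
     ([tjudg 2 u v w], tjudg 2 (TSuc u) (tcons x v) w),
     ([], tjudg 3 (TPair n n) u n),
     ([], tjudg 3 (TPair (tnum 1) n) (tcons u v) (TSuc u)),
     ([tjudg 2 u v w], tjudg 3 (TPair (tnum 2) u) v w),
     ([tjudg 4 v w x, tjudg 3 u x y], tjudg 3 (TPair (tnum 3) (TPair u v)) w y),
     ([tjudg 3 u w x, tjudg 0 v n n], tjudg 3 (TPair (tnum 4) (TPair u v)) (tcons n w) x),
     ([tjudg 3 (TPair (tnum 4) (TPair u v)) (tcons w x) y, tjudg 3 v (tcons w (tcons y x)) z],
       tjudg 3 (TPair (tnum 4) (TPair u v)) (tcons (TSuc w) x) z),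
     ([tjudg 3 u (tcons w v) n, tjudg 5 u v w], tjudg 3 (TPair (tnum 5) u) v w),
     ([], tjudg 4 n u n),
     ([tjudg 3 u v w, tjudg 4 x v y], tjudg 4 (tcons u x) v (tcons w y)),
     ([], tjudg 5 u v n),
     ([tjudg 5 u v w, tjudg 3 u (tcons w v) (TSuc x)], tjudg 5 u v (TSuc w)),
     ([tjudg 4 u v w, tjudg 2 x w y, tjudg 3 y (tcons z n) (TVar 6)], tjudg 6 u v (TPair x z))])"

text \<open>Seven variables: the clauses mention \<open>TVar 0\<close> to
  \<open>TVar 6\<close>.\<close>

definition D :: "nat set" where
  "D = derivable eval_clauses 7"

lemma tval_tnum [simp]: "tval env (tnum n) = n"
  by (induction n) auto

lemma tval_tjudg [simp]: "tval env (tjudg t a b c) = judg t (tval env a) (tval env b) (tval env c)"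
  by (simp add: tjudg_def judg_def)

lemma tval_tcons [simp]: "tval env (tcons x r) = lcons (tval env x) (tval env r)"
  by (simp add: tcons_def lcons_def)

lemma list_decode_lcons [simp]: "list_decode (lcons x r) = x # list_decode r"
  by (simp add: lcons_def)

lemma lcons_list_encode [simp]: "lcons x (list_encode xs) = list_encode (x # xs)"
  by (simp add: lcons_def)

lemma judg_eq [simp]: "judg t a b c = judg t' a' b' c' \<longleftrightarrow> t = t' \<and> a = a' \<and> b = b' \<and> c = c'"
  by (simp add: judg_def)

definition closed_at :: "(nat \<Rightarrow> bool) \<Rightarrow> nat list \<Rightarrow> tm list \<times> tm \<Rightarrow> bool" where
  "closed_at S env cl \<longleftrightarrow> (list_all (\<lambda>p. S (tval env p)) (fst cl) \<longrightarrow> S (tval env (snd cl)))"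

lemma D_closed: "list_all (closed_at (\<lambda>j. j \<in> D) [x0, x1, x2, x3, x4, x5, x6]) eval_clauses"
  unfolding list_all_iff closed_at_def
proof (intro ballI impI)
  fix cl assume "cl \<in> set eval_clauses" "\<forall>p\<in>set (fst cl). tval [x0, x1, x2, x3, x4, x5, x6] p \<in> D"
  then show "tval [x0, x1, x2, x3, x4, x5, x6] (snd cl) \<in> D"
    using derivable.intros[of "fst cl" "snd cl" eval_clauses "[x0, x1, x2, x3, x4, x5, x6]" 7]
    by (simp add: D_def del: tval.simps)
qed

text \<open>Rule induction with the assignment split into seven named values, so that simplification
  can evaluate every term of the clause list.\<close>

lemma D_induct:
  assumes "j \<in> D"
    and "\<And>x0 x1 x2 x3 x4 x5 x6. list_all (closed_at S [x0, x1, x2, x3, x4, x5, x6]) eval_clauses"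
  shows "S j"
  using assms(1) unfolding D_def
proof induction
  case (1 ps c env)
  then obtain x0 x1 x2 x3 x4 x5 x6 where "env = [x0, x1, x2, x3, x4, x5, x6]"
    by (auto simp: eval_nat_numeral length_Suc_conv)
  with assms(2)[of x0 x1 x2 x3 x4 x5 x6] 1(1,3) show ?case
    by (auto simp: list_all_iff closed_at_def simp del: tval.simps)
qed

lemmas D_closed_unfolded = D_closed[unfolded eval_clauses_def Let_def, simplified list.pred_inject,
  unfolded closed_at_def, simplified]

text \<open>Same order as in \<open>eval_clauses\<close>; the completeness proofs cite these rules
  by position.\<close>

lemma D_rules:
  "judg 0 (prod_encode (0, 0)) 0 0 \<in> D"
  "judg 0 (prod_encode (1, 0)) 0 0 \<in> D"
  "judg 0 (prod_encode (2, u)) 0 0 \<in> D"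
  "judg 0 u 0 0 \<in> D \<Longrightarrow> judg 1 v 0 0 \<in> D \<Longrightarrow> judg 0 (prod_encode (3, prod_encode (u, v))) 0 0 \<in> D"
  "judg 0 u 0 0 \<in> D \<Longrightarrow> judg 0 v 0 0 \<in> D \<Longrightarrow> judg 0 (prod_encode (4, prod_encode (u, v))) 0 0 \<in> D"
  "judg 0 u 0 0 \<in> D \<Longrightarrow> judg 0 (prod_encode (5, u)) 0 0 \<in> D"
  "judg 1 0 0 0 \<in> D"
  "judg 0 u 0 0 \<in> D \<Longrightarrow> judg 1 v 0 0 \<in> D \<Longrightarrow> judg 1 (lcons u v) 0 0 \<in> D"
  "judg 2 0 (lcons u v) u \<in> D"
  "judg 2 u v w \<in> D \<Longrightarrow> judg 2 (Suc u) (lcons x v) w \<in> D"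
  "judg 3 (prod_encode (0, 0)) u 0 \<in> D"
  "judg 3 (prod_encode (1, 0)) (lcons u v) (Suc u) \<in> D"
  "judg 2 u v w \<in> D \<Longrightarrow> judg 3 (prod_encode (2, u)) v w \<in> D"
  "judg 4 v w x \<in> D \<Longrightarrow> judg 3 u x y \<in> D \<Longrightarrow> judg 3 (prod_encode (3, prod_encode (u, v))) w y \<in> D"
  "judg 3 u w x \<in> D \<Longrightarrow> judg 0 v 0 0 \<in> D \<Longrightarrow>
    judg 3 (prod_encode (4, prod_encode (u, v))) (lcons 0 w) x \<in> D"
  "judg 3 (prod_encode (4, prod_encode (u, v))) (lcons w x) y \<in> D \<Longrightarrow>
    judg 3 v (lcons w (lcons y x)) z \<in> D \<Longrightarrow>
    judg 3 (prod_encode (4, prod_encode (u, v))) (lcons (Suc w) x) z \<in> D"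
  "judg 3 u (lcons w v) 0 \<in> D \<Longrightarrow> judg 5 u v w \<in> D \<Longrightarrow> judg 3 (prod_encode (5, u)) v w \<in> D"
  "judg 4 0 u 0 \<in> D"
  "judg 3 u v w \<in> D \<Longrightarrow> judg 4 x v y \<in> D \<Longrightarrow> judg 4 (lcons u x) v (lcons w y) \<in> D"
  "judg 5 u v 0 \<in> D"
  "judg 5 u v w \<in> D \<Longrightarrow> judg 3 u (lcons w v) (Suc x) \<in> D \<Longrightarrow> judg 5 u v (Suc w) \<in> D"
  "judg 4 u v w \<in> D \<Longrightarrow> judg 2 x w y \<in> D \<Longrightarrow> judg 3 y (lcons z 0) k \<in> D \<Longrightarrow>
    judg 6 u v (prod_encode (x, z)) \<in> D"
  by (simp_all add: D_closed_unfolded[of u v w x y z k])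

section \<open>Completeness of the clauses for evaluation\<close>

lemma D_complete_program: "judg 0 (code p) 0 0 \<in> D"
proof (induction p)
  case (Comp f gs)
  have "judg 1 (list_encode (map code hs)) 0 0 \<in> D" if "set hs \<subseteq> set gs" for hs
    using that
  proof (induction hs)
    case Nil
    show ?case using D_rules(7) by simp
  next
    case (Cons h hs)
    then show ?case
      using Comp.IH(2) D_rules(8)[of "code h" "list_encode (map code hs)"] by simp
  qed
  then show ?case using Comp.IH(1) D_rules(4) by simp
qed (use D_rules in simp_all)

lemma D_complete_nth: "i < length xs \<Longrightarrow> judg 2 i (list_encode xs) (xs ! i) \<in> D"
proof (induction xs arbitrary: i)
  case (Cons x xs)
  then show ?case
    using D_rules(9)[of x "list_encode xs"] D_rules(10)[of "i - 1" "list_encode xs" "xs ! (i - 1)" x]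
    by (cases i) auto
qed simp

lemma D_complete_list:
  "list_all2 (\<lambda>g y. judg 3 (code g) v y \<in> D) gs ys \<Longrightarrow>
    judg 4 (list_encode (map code gs)) v (list_encode ys) \<in> D"
proof (induction rule: list_all2_induct)
  case Nil
  show ?case using D_rules(18) by simp
next
  case (Cons g gs y ys)
  then show ?case
    using D_rules(19)[of "code g" v y "list_encode (map code gs)" "list_encode ys"] by simp
qed

lemma D_complete_eval: "eval p xs y \<Longrightarrow> judg 3 (code p) (list_encode xs) y \<in> D"
proof (induction rule: eval.induct)
  case (eval_Zero xs)
  show ?case using D_rules(11) by simp
next
  case (eval_Succ x xs)
  show ?case using D_rules(12)[of x "list_encode xs"] by simp
next
  case (eval_Proj n xs)
  then show ?case using D_rules(13) D_complete_nth by simp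
next
  case (eval_Comp xs gs ys f z)
  have "judg 4 (list_encode (map code gs)) (list_encode xs) (list_encode ys) \<in> D"
    by (rule D_complete_list) (use eval_Comp.IH(1) in \<open>auto elim: list_all2_mono\<close>)
  then show ?case using D_rules(14) eval_Comp.IH(2) by simp
next
  case (eval_Prim0 f xs y g)
  then show ?case
    using D_rules(15)[of "code f" "list_encode xs" y "code g"] D_complete_program by simp
next
  case (eval_PrimS f g n xs y z)
  then show ?case
    using D_rules(16)[of "code f" "code g" n "list_encode xs" y z] by (simp add: lcons_def)
next
  case (eval_Mu f n xs)
  \<comment> \<open>The bounded universal premise of \<open>eval_Mu\<close> is not a Horn premise;
    judgement 5 builds it up one argument at a time.\<close>
  have "judg 5 (code f) (list_encode xs) m \<in> D" if "m \<le> n" for m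
    using that
  proof (induction m)
    case 0
    show ?case by (rule D_rules(20))
  next
    case (Suc m)
    then obtain y where "judg 3 (code f) (list_encode (m # xs)) (Suc y) \<in> D"
      using eval_Mu.IH(2) gr0_conv_Suc by (metis Suc_le_eq)
    with Suc show ?case
      using D_rules(21)[of "code f" "list_encode xs" m y] by simp
  qed
  then show ?case
    using D_rules(17)[of "code f" n "list_encode xs"] eval_Mu.IH(1) by simp
qed

section \<open>Soundness of the clauses for evaluation\<close>

definition sem :: "nat \<Rightarrow> nat \<Rightarrow> nat \<Rightarrow> nat \<Rightarrow> bool" where
  "sem t a b c \<longleftrightarrow>
    (t = 0 \<longrightarrow> a \<in> range code) \<and>
    (t = 1 \<longrightarrow> a \<in> range (\<lambda>ps. list_encode (map code ps))) \<and>
    (t = 2 \<longrightarrow> a < length (list_decode b) \<and> list_decode b ! a = c) \<and>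
    (t = 3 \<longrightarrow> (\<exists>p. code p = a \<and> eval p (list_decode b) c)) \<and>
    (t = 4 \<longrightarrow> (\<exists>ps. list_encode (map code ps) = a \<and>
       list_all2 (\<lambda>p y. eval p (list_decode b) y) ps (list_decode c))) \<and>
    (t = 5 \<longrightarrow> (\<forall>p. code p = a \<longrightarrow> (\<forall>m<c. \<exists>y. eval p (m # list_decode b) y \<and> y > 0))) \<and>
    (t = 6 \<longrightarrow> (\<exists>ps ys. list_encode (map code ps) = a \<and> list_all2 (\<lambda>p y. eval p (list_decode b) y) ps ys \<and>
       (case prod_decode c of (i, x) \<Rightarrow> i < length ys \<and> x \<in> W (ys ! i))))"

lemma code_eqD:
  "code p = prod_encode (3, prod_encode (u, v)) \<Longrightarrow>
    \<exists>f gs. p = Comp f gs \<and> code f = u \<and> list_encode (map code gs) = v"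
  "code p = prod_encode (4, prod_encode (u, v)) \<Longrightarrow> \<exists>f g. p = Prim f g \<and> code f = u \<and> code g = v"
  "code p = prod_encode (5, u) \<Longrightarrow> \<exists>f. p = Mu f \<and> code f = u"
  by (cases p; simp)+

text \<open>The intended meaning \<open>sem\<close> is closed under each clause; the order is that
  of \<open>D_rules\<close>.\<close>

lemma sem_rules:
  "sem 0 (prod_encode (0, 0)) 0 0"
  "sem 0 (prod_encode (1, 0)) 0 0"
  "sem 0 (prod_encode (2, u)) 0 0"
  "sem 0 u 0 0 \<Longrightarrow> sem 1 v 0 0 \<Longrightarrow> sem 0 (prod_encode (3, prod_encode (u, v))) 0 0"
  "sem 0 u 0 0 \<Longrightarrow> sem 0 v 0 0 \<Longrightarrow> sem 0 (prod_encode (4, prod_encode (u, v))) 0 0"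
  "sem 0 u 0 0 \<Longrightarrow> sem 0 (prod_encode (5, u)) 0 0"
  "sem 1 0 0 0"
  "sem 0 u 0 0 \<Longrightarrow> sem 1 v 0 0 \<Longrightarrow> sem 1 (lcons u v) 0 0"
  "sem 2 0 (lcons u v) u"
  "sem 2 u v w \<Longrightarrow> sem 2 (Suc u) (lcons x v) w"
  "sem 3 (prod_encode (0, 0)) u 0"
  "sem 3 (prod_encode (1, 0)) (lcons u v) (Suc u)"
  "sem 2 u v w \<Longrightarrow> sem 3 (prod_encode (2, u)) v w"
  "sem 4 v w x \<Longrightarrow> sem 3 u x y \<Longrightarrow> sem 3 (prod_encode (3, prod_encode (u, v))) w y"
  "sem 3 u w x \<Longrightarrow> sem 0 v 0 0 \<Longrightarrow> sem 3 (prod_encode (4, prod_encode (u, v))) (lcons 0 w) x"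
  "sem 3 (prod_encode (4, prod_encode (u, v))) (lcons w x) y \<Longrightarrow>
    sem 3 v (lcons w (lcons y x)) z \<Longrightarrow> sem 3 (prod_encode (4, prod_encode (u, v))) (lcons (Suc w) x) z"
  "sem 3 u (lcons w v) 0 \<Longrightarrow> sem 5 u v w \<Longrightarrow> sem 3 (prod_encode (5, u)) v w"
  "sem 4 0 u 0"
  "sem 3 u v w \<Longrightarrow> sem 4 x v y \<Longrightarrow> sem 4 (lcons u x) v (lcons w y)"
  "sem 5 u v 0"
  "sem 5 u v w \<Longrightarrow> sem 3 u (lcons w v) (Suc x) \<Longrightarrow> sem 5 u v (Suc w)"
  "sem 4 u v w \<Longrightarrow> sem 2 x w y \<Longrightarrow> sem 3 y (lcons z 0) k \<Longrightarrow> sem 6 u v (prod_encode (x, z))"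
proof -
  note [simp] = sem_def image_iff
  show "sem 0 (prod_encode (0, 0)) 0 0"
    by (auto intro: exI[of _ Zero])
  show "sem 0 (prod_encode (1, 0)) 0 0"
    by (auto intro: exI[of _ Succ])
  show "sem 0 (prod_encode (2, u)) 0 0"
    by (auto intro: exI[of _ "Proj u"])
  show "sem 0 (prod_encode (3, prod_encode (u, v))) 0 0" if "sem 0 u 0 0" "sem 1 v 0 0"
  proof -
    from that obtain f gs where "u = code f" "v = list_encode (map code gs)" by auto
    then show ?thesis by (auto intro: exI[of _ "Comp f gs"])
  qed
  show "sem 0 (prod_encode (4, prod_encode (u, v))) 0 0" if "sem 0 u 0 0" "sem 0 v 0 0"
  proof -
    from that obtain f g where "u = code f" "v = code g" by auto
    then show ?thesis by (auto intro: exI[of _ "Prim f g"])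
  qed
  show "sem 0 (prod_encode (5, u)) 0 0" if "sem 0 u 0 0"
  proof -
    from that obtain f where "u = code f" by auto
    then show ?thesis by (auto intro: exI[of _ "Mu f"])
  qed
  show "sem 1 0 0 0"
    by (auto intro: exI[of _ "[]"])
  show "sem 1 (lcons u v) 0 0" if "sem 0 u 0 0" "sem 1 v 0 0"
  proof -
    from that obtain f gs where "u = code f" "v = list_encode (map code gs)" by auto
    then show ?thesis by (auto intro: exI[of _ "f # gs"])
  qed
  show "sem 2 0 (lcons u v) u" by simp
  show "sem 2 (Suc u) (lcons x v) w" if "sem 2 u v w" using that by simp
  show "sem 3 (prod_encode (0, 0)) u 0"
    by (auto intro!: exI[of _ Zero] eval_Zero)
  show "sem 3 (prod_encode (1, 0)) (lcons u v) (Suc u)"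
    by (auto intro!: exI[of _ Succ] eval_Succ)
  show "sem 3 (prod_encode (2, u)) v w" if "sem 2 u v w"
    using that by (auto intro!: exI[of _ "Proj u"] eval_Proj)
  show "sem 3 (prod_encode (3, prod_encode (u, v))) w y" if "sem 4 v w x" "sem 3 u x y"
  proof -
    from that obtain f gs where "u = code f" "v = list_encode (map code gs)"
      "list_all2 (\<lambda>p y. eval p (list_decode w) y) gs (list_decode x)" "eval f (list_decode x) y"
      by auto
    then show ?thesis by (auto intro!: exI[of _ "Comp f gs"] eval_Comp)
  qed
  show "sem 3 (prod_encode (4, prod_encode (u, v))) (lcons 0 w) x" if "sem 3 u w x" "sem 0 v 0 0"
  proof -
    from that obtain f g where "u = code f" "v = code g" "eval f (list_decode w) x" by auto
    then show ?thesis by (auto intro!: exI[of _ "Prim f g"] eval_Prim0)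
  qed
  show "sem 3 (prod_encode (4, prod_encode (u, v))) (lcons (Suc w) x) z"
    if *: "sem 3 (prod_encode (4, prod_encode (u, v))) (lcons w x) y" "sem 3 v (lcons w (lcons y x)) z"
  proof -
    from *(1) obtain p where p: "code p = prod_encode (4, prod_encode (u, v))" "eval p (w # list_decode x) y"
      by auto
    then obtain f g where fg: "p = Prim f g" "code f = u" "code g = v"
      using code_eqD(2) by blast
    \<comment> \<open>Each premise yields its own program with code \<open>v\<close>; injectivity of
      \<open>code\<close> identifies them.\<close>
    from *(2) obtain q where "code q = v" "eval q (w # y # list_decode x) z" by auto
    with fg(3) have "eval g (w # y # list_decode x) z" using code_inject[of q g] by simp
    then have "eval (Prim f g) (Suc w # list_decode x) z"
      using eval_PrimS[of f g w "list_decode x" y z] p(2) fg(1) by blast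
    with fg(2,3) show ?thesis by (auto intro!: exI[of _ "Prim f g"])
  qed
  show "sem 3 (prod_encode (5, u)) v w" if "sem 3 u (lcons w v) 0" "sem 5 u v w"
  proof -
    from that(1) obtain f where "code f = u" "eval f (w # list_decode v) 0" by auto
    with that(2) show ?thesis by (auto intro!: exI[of _ "Mu f"] eval_Mu)
  qed
  show "sem 4 0 u 0" by (auto intro: exI[of _ "[]"])
  show "sem 4 (lcons u x) v (lcons w y)" if "sem 3 u v w" "sem 4 x v y"
  proof -
    from that obtain f gs where "u = code f" "x = list_encode (map code gs)"
      "list_all2 (\<lambda>p y. eval p (list_decode v) y) gs (list_decode y)" "eval f (list_decode v) w"
      by auto
    then show ?thesis by (auto intro!: exI[of _ "f # gs"])
  qed
  \<comment> \<open>Judgement 5 quantifies universally over programs with code \<open>u\<close>, so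
    this also holds if \<open>u\<close> codes no program.\<close>
  show "sem 5 u v 0" by simp
  show "sem 5 u v (Suc w)" if "sem 5 u v w" "sem 3 u (lcons w v) (Suc x)"
  proof -
    from that(2) obtain q where q: "code q = u" "eval q (w # list_decode v) (Suc x)" by auto
    have "\<exists>y. eval p (m # list_decode v) y \<and> y > 0" if "code p = u" "m < Suc w" for p m
    proof -
      have "p = q" by (rule code_inject) (simp add: q(1) that(1))
      with \<open>sem 5 u v w\<close> q that(2) show ?thesis by (cases "m = w") auto
    qed
    then show ?thesis by simp
  qed
  show "sem 6 u v (prod_encode (x, z))" if "sem 4 u v w" "sem 2 x w y" "sem 3 y (lcons z 0) k"
  proof -
    from that(1) obtain ps where "list_encode (map code ps) = u"
      "list_all2 (\<lambda>p y. eval p (list_decode v) y) ps (list_decode w)" by auto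
    moreover have "z \<in> W y" using that(3) by (auto simp: W_def)
    ultimately show ?thesis using that(2) by auto
  qed
qed

lemma D_sound:
  assumes "judg t a b c \<in> D"
  shows "sem t a b c"
proof -
  \<comment> \<open>\<open>D_induct\<close> expects a predicate on single numbers; \<open>S\<close>
    recovers the components, which are unique as \<open>judg\<close> is injective.\<close>
  define S where "S j = (\<forall>t a b c. j = judg t a b c \<longrightarrow> sem t a b c)" for j
  have S: "S (judg t a b c) = sem t a b c" for t a b c
    by (auto simp: S_def)
  have "S (judg t a b c)"
  proof (rule D_induct[OF assms])
    fix u v w x y z k
    show "list_all (closed_at S [u, v, w, x, y, z, k]) eval_clauses"
      unfolding eval_clauses_def Let_def list.pred_inject
      unfolding closed_at_def
      by (simp add: S, intro conjI impI; (elim conjE)?; rule sem_rules[unfolded One_nat_def]; assumption)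
  qed
  then show ?thesis by (simp add: S)
qed

text \<open>The link to the diagonalization: soundness and determinism force the outputs found by a
  derivation to be \<open>ys\<close>; conversely, completeness supplies the three premises of the
  clause for judgement 6.\<close>

lemma judg_W_iff:
  assumes "length ys = length ps" "\<And>i. i < length ps \<Longrightarrow> eval (ps ! i) xs (ys ! i)" "i < length ps"
  shows "judg 6 (list_encode (map code ps)) (list_encode xs) (prod_encode (i, x)) \<in> D \<longleftrightarrow> x \<in> W (ys ! i)"
    (is "?L \<longleftrightarrow> ?R")
proof
  assume ?L
  from D_sound[OF this] obtain qs zs where
    "map code qs = map code ps" "list_all2 (\<lambda>p y. eval p xs y) qs zs" "i < length zs" "x \<in> W (zs ! i)"
    by (auto simp: sem_def list_encode_eq)
  moreover from this(1) have "qs = ps"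
    using inj_map_eq_map[of code qs ps] code_inject by (auto simp: inj_def)
  ultimately show ?R
    using assms(2,3) eval_deterministic[of "ps ! i" xs "zs ! i" "ys ! i"]
    by (auto simp: list_all2_conv_all_nth)
next
  assume ?R
  then obtain p y where p: "code p = ys ! i" "eval p [x] y" by (auto simp: W_def)
  have "judg 4 (list_encode (map code ps)) (list_encode xs) (list_encode ys) \<in> D"
    by (rule D_complete_list) (use assms D_complete_eval in \<open>auto simp: list_all2_conv_all_nth\<close>)
  moreover have "judg 2 i (list_encode ys) (ys ! i) \<in> D"
    using assms by (intro D_complete_nth) auto
  moreover have "judg 3 (ys ! i) (lcons x 0) y \<in> D"
    using D_complete_eval[OF p(2)] p(1) by (simp add: lcons_def)
  ultimately show ?L by (rule D_rules(22))
qed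

section \<open>Indices of c.e. sets\<close>

primrec const_prog :: "nat \<Rightarrow> recf" where
  "const_prog 0 = Zero"
| "const_prog (Suc n) = Comp Succ [const_prog n]"

lemma eval_const_prog: "eval (const_prog n) xs n"
proof (induction n)
  case (Suc n)
  then show ?case by (auto intro!: eval_Comp[where ys = "[n]"] eval_Succ)
qed (simp add: eval_Zero)

lemma computable_code_const_prog:
  assumes "computable k f"
  shows "computable k (\<lambda>xs. code (const_prog (f xs)))"
proof (rule computable_unary[where F = "\<lambda>n. code (const_prog n)", OF _ assms])
  \<comment> \<open>\<open>Suc (prod_encode (c, 0))\<close> codes the list \<open>[c]\<close>, so
    \<open>h\<close> wraps one more \<open>Comp Succ\<close> around the accumulated code at position
    1.\<close>
  define h where "h ys = prod_encode (3, prod_encode (code Succ, Suc (prod_encode (ys ! 1, 0))))"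
    for ys :: "nat list"
  have "computable 3 h"
    unfolding h_def by (intro computable_prod_encode computable_Suc computable_const computable_nth) simp
  then have "computable 1 (\<lambda>xs. rec_nat (code Zero) (\<lambda>i a. h (i # a # xs)) (xs ! 0))"
    by (intro computable_rec_nat computable_const computable_nth) (auto simp: numeral_3_eq_3)
  moreover have "rec_nat (code Zero) (\<lambda>i a. h (i # a # xs)) n = code (const_prog n)" for n xs
    by (induction n) (auto simp: h_def)
  ultimately show "computable 1 (\<lambda>xs. code (const_prog (xs ! 0)))" by simp
qed

lemma computable_list_encode:
  "(\<And>g. g \<in> set gs \<Longrightarrow> computable k g) \<Longrightarrow> computable k (\<lambda>xs. list_encode (map (\<lambda>g. g xs) gs))"
  by (induction gs) (auto intro!: computable_const computable_Suc computable_prod_encode)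

lemma W_code: "W (code p) = {x. \<exists>y. eval p [x] y}"
  unfolding W_def using code_inject by blast

text \<open>An s-m-n argument: the parameters \<open>xs\<close> are built into the program as
  constants, \<open>Proj 0\<close> supplies the input \<open>m\<close>, and \<open>Mu\<close>
  searches for \<open>s\<close>.\<close>

lemma ce_index:
  assumes "decidable (Suc (Suc k)) P"
  obtains g where "computable k g" "\<And>xs. length xs = k \<Longrightarrow> W (g xs) = {m. \<exists>s. P (s # m # xs)}"
proof -
  \<comment> \<open>Negated because \<open>Mu\<close> searches for a zero.\<close>
  obtain p where p: "\<And>ys. length ys = Suc (Suc k) \<Longrightarrow> eval p ys (if \<not> P ys then 1 else 0)"
    using decidable_not[OF assms] unfolding decidable_def by blast
  define g where "g xs = code (Comp (Mu p) (Proj 0 # map const_prog xs))" for xs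
  have "computable k (\<lambda>xs. list_encode (map (\<lambda>g. g xs) (map (\<lambda>i xs. code (const_prog (xs ! i))) [0..<k])))"
    by (rule computable_list_encode) (auto intro!: computable_code_const_prog computable_nth)
  then have "computable k (\<lambda>xs. list_encode (map code (map const_prog xs)))"
  proof (rule computable_cong)
    fix xs :: "nat list" assume "length xs = k"
    then have "map (\<lambda>g. g xs) (map (\<lambda>i xs. code (const_prog (xs ! i))) [0..<k]) = map code (map const_prog xs)"
      by (auto simp: list_eq_iff_nth_eq)
    then show "list_encode (map (\<lambda>g. g xs) (map (\<lambda>i xs. code (const_prog (xs ! i))) [0..<k])) =
        list_encode (map code (map const_prog xs))"
      by (simp only:)
  qed
  then have "computable k (\<lambda>xs. prod_encode (3, prod_encode (code (Mu p),
      Suc (prod_encode (code (Proj 0), list_encode (map code (map const_prog xs)))))))"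
    by (intro computable_prod_encode computable_Suc computable_const)
  then have "computable k g" by (rule computable_cong) (simp add: g_def)
  moreover have "W (g xs) = {m. \<exists>s. P (s # m # xs)}" if xs: "length xs = k" for xs
  proof -
    have args: "list_all2 (\<lambda>h y. eval h [m] y) (Proj 0 # map const_prog xs) (m # xs)" for m
      using eval_Proj[of 0 "[m]"] by (auto simp: list_all2_conv_all_nth nth_Cons eval_const_prog split: nat.split)
    have "(\<exists>y. eval (Comp (Mu p) (Proj 0 # map const_prog xs)) [m] y) \<longleftrightarrow> (\<exists>y. eval (Mu p) (m # xs) y)" for m
    proof
      assume "\<exists>y. eval (Comp (Mu p) (Proj 0 # map const_prog xs)) [m] y"
      then obtain y ys where ys: "list_all2 (\<lambda>h y. eval h [m] y) (Proj 0 # map const_prog xs) ys"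
        "eval (Mu p) ys y" by (auto elim: eval_CompE)
      have "ys = m # xs"
      proof (rule nth_equalityI)
        show "length ys = length (m # xs)" using ys(1) by (auto dest: list_all2_lengthD)
        show "ys ! i = (m # xs) ! i" if "i < length ys" for i
          using that ys(1) args[of m] by (metis eval_deterministic list_all2_conv_all_nth)
      qed
      with ys(2) show "\<exists>y. eval (Mu p) (m # xs) y" by blast
    qed (use args eval_Comp in blast)
    moreover have "(\<exists>y. eval (Mu p) (m # xs) y) \<longleftrightarrow> (\<exists>s. P (s # m # xs))" for m
    proof
      assume "\<exists>y. eval (Mu p) (m # xs) y"
      then obtain s where "eval p (s # m # xs) 0" by (auto elim: eval_MuE)
      from eval_deterministic[OF this p] xs show "\<exists>s. P (s # m # xs)"
        by (auto split: if_splits)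
    next
      assume ex: "\<exists>s. P (s # m # xs)"
      define s where "s = (LEAST s. P (s # m # xs))"
      have "P (s # m # xs)" using ex unfolding s_def by (rule LeastI_ex)
      moreover have "\<not> P (t # m # xs)" if "t < s" for t
        using that unfolding s_def by (rule not_less_Least)
      ultimately have "eval (Mu p) (m # xs) s"
        using p[of "_ # m # xs"] xs by (intro eval_Mu) (force split: if_splits)+
      then show "\<exists>y. eval (Mu p) (m # xs) y" by blast
    qed
    ultimately show ?thesis by (simp add: g_def W_code del: code.simps)
  qed
  ultimately show thesis by (rule that)
qed

section \<open>Ternary completeness\<close>

text \<open>Finitely many witnesses have a common bound. A single number \<open>s\<close> can thus
  witness a bounded initial part of a \<open>\<Pi>\<^sup>0\<^sub>2\<close> condition, which is
  therefore c.e.\<close>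

lemma ex_bound_iff: "(\<exists>s. \<forall>a<n. \<exists>b<s. P a b) \<longleftrightarrow> (\<forall>a<n. \<exists>b. P a b)" for n :: nat and P :: "nat \<Rightarrow> nat \<Rightarrow> bool"
proof
  assume "\<forall>a<n. \<exists>b. P a b"
  then obtain h where h: "\<And>a. a < n \<Longrightarrow> P a (h a)" by metis
  have "h a < Suc (\<Sum>a<n. h a)" if "a < n" for a
    using member_le_sum[of a "{..<n}" h] that by simp
  with h show "\<exists>s. \<forall>a<n. \<exists>b<s. P a b" by blast
qed blast

lemma maxset_finite: "finite A \<Longrightarrow> A \<noteq> {} \<Longrightarrow> maxset A = ereal (real (Max A))"
  by (simp add: maxset_def)

lemma maxset_infinite: "infinite A \<Longrightarrow> maxset A = \<infinity>"
  by (auto simp: maxset_def)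

lemma ternary_complete:
  assumes equiv: "equiv UNIV R" and "pi02 R"
  shows "creduce 3 R Emax_ce"
proof -
  obtain Q where Q: "decidable 4 Q" and R: "\<And>x y. (x, y) \<in> R \<longleftrightarrow> (\<forall>a. \<exists>b. Q [x, y, a, b])"
    using \<open>pi02 R\<close> unfolding pi02_def by blast
  \<comment> \<open>The arguments are \<open>s # m # xs\<close>: a search bound, the candidate
    element, and the three entries from position 2 on. The first conjunct says that \<open>m\<close>
    has residue \<open>i\<close> modulo 3.\<close>
  define P where "P i ys \<longleftrightarrow> (\<exists>q<Suc (ys ! 1). ys ! 1 = 3 * q + i) \<and>
    (ys ! 1 = i \<or> (\<exists>j\<in>set (filter (\<lambda>j. j \<noteq> i) [0, 1, 2]).
      \<forall>a<Suc (ys ! 1). \<exists>b<ys ! 0. Q [ys ! (i + 2), ys ! (j + 2), a, b]))" for i :: nat and ys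
  define V where "V i xs = {m. m mod 3 = i \<and> (m = i \<or> (\<exists>j\<in>{0, 1, 2} - {i}.
      \<forall>a<Suc m. \<exists>b. Q [xs ! i, xs ! j, a, b]))}" for i :: nat and xs
  have "\<exists>g. computable 3 g \<and> (\<forall>xs. length xs = 3 \<longrightarrow> W (g xs) = V i xs)" if "i < 3" for i
  proof -
    have "decidable 5 (P i)"
      unfolding P_def
      by (intro decidable_conj decidable_disj decidable_bex decidable_Bex_set decidable_ball decidable_eq
          decidable_quaternary[OF Q] computable_Suc computable_add computable_mult computable_const
          computable_nths) (use that in \<open>auto split: if_splits\<close>)
    then have "decidable (Suc (Suc 3)) (P i)" by (simp add: eval_nat_numeral)
    then obtain g where g: "computable 3 g" "\<And>xs. length xs = 3 \<Longrightarrow> W (g xs) = {m. \<exists>s. P i (s # m # xs)}"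
      by (rule ce_index) (rule that)
    have "(\<exists>s. P i (s # m # xs)) \<longleftrightarrow> m \<in> V i xs" for m xs
    proof -
      have "(\<exists>q<Suc m. m = 3 * q + i) \<longleftrightarrow> m mod 3 = i"
        using that by (auto intro!: exI[of _ "m div 3"])
      moreover have "(\<exists>s. \<exists>j\<in>J. \<forall>a<Suc m. \<exists>b<s. Q [xs ! i, xs ! j, a, b]) \<longleftrightarrow>
          (\<exists>j\<in>J. \<forall>a<Suc m. \<exists>b. Q [xs ! i, xs ! j, a, b])" for J
        using ex_bound_iff[of "Suc m" "\<lambda>a b. Q [xs ! i, xs ! _, a, b]"] by meson
      moreover have "set (filter (\<lambda>j. j \<noteq> i) [0, 1, 2]) = {0, 1, 2} - {i}" by auto
      ultimately show ?thesis
        unfolding P_def V_def by simp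
    qed
    with g show ?thesis by auto
  qed
  then obtain g where g: "\<And>i. i < 3 \<Longrightarrow> computable 3 (g i)"
    "\<And>i xs. i < 3 \<Longrightarrow> length xs = 3 \<Longrightarrow> W (g i xs) = V i xs"
    by metis
  have inf: "infinite (V i xs) \<longleftrightarrow> (\<exists>j\<in>{0, 1, 2} - {i}. (xs ! i, xs ! j) \<in> R)" if "i < 3" for i xs
  proof
    assume "\<exists>j\<in>{0, 1, 2} - {i}. (xs ! i, xs ! j) \<in> R"
    then have "range (\<lambda>q. 3 * q + i) \<subseteq> V i xs"
      using that by (auto simp: V_def R)
    moreover have "infinite (range (\<lambda>q. 3 * q + i))"
      by (intro range_inj_infinite) (auto simp: inj_def)
    ultimately show "infinite (V i xs)" by (rule infinite_super)
  next
    assume inf: "infinite (V i xs)"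
    show "\<exists>j\<in>{0, 1, 2} - {i}. (xs ! i, xs ! j) \<in> R"
    proof (rule ccontr)
      assume "\<not> ?thesis"
      \<comment> \<open>At \<open>c j\<close> the condition for \<open>j\<close> fails, so no
        \<open>m \<ge> c j\<close> can enter \<open>V i xs\<close> on account of
        \<open>j\<close>.\<close>
      then obtain c where c: "\<And>j. j \<in> {0, 1, 2} - {i} \<Longrightarrow> \<not> (\<exists>b. Q [xs ! i, xs ! j, c j, b])"
        unfolding R by metis
      have "m < Suc (i + c 0 + c 1 + c 2)" if "m \<in> V i xs" for m
      proof (cases "m = i")
        case False
        then obtain j where j: "j \<in> {0, 1, 2} - {i}" "\<forall>a<Suc m. \<exists>b. Q [xs ! i, xs ! j, a, b]"
          using \<open>m \<in> V i xs\<close> by (auto simp: V_def)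
        with c[OF j(1)] have "\<not> c j < Suc m" by blast
        with j(1) show ?thesis by auto
      qed simp
      then have "V i xs \<subseteq> {..<Suc (i + c 0 + c 1 + c 2)}" by blast
      with inf show False using finite_subset by blast
    qed
  qed
  define f where "f xs = map (\<lambda>i. g i xs) [0..<3]" for xs
  show ?thesis
    unfolding creduce_def
  proof (intro exI[of _ f] conjI allI impI)
    show "\<exists>p. \<forall>xs. length xs = 3 \<longrightarrow> eval p xs (f xs ! i)" if "i < 3" for i
      using g(1)[OF that] that unfolding computable_def f_def by simp
    show "length (f xs) = 3" for xs by (simp add: f_def)
    fix xs :: "nat list" and i j :: nat
    assume len: "length xs = 3" and ij: "i < j \<and> j < 3"
    have W: "W (f xs ! i) = V i xs" "W (f xs ! j) = V j xs"
      using g(2)[of i xs] g(2)[of j xs] ij len by (auto simp: f_def)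
    have "i \<in> V i xs" "j \<in> V j xs" using ij by (auto simp: V_def)
    then have ne: "V i xs \<noteq> {}" "V j xs \<noteq> {}" by blast+
    have sym: "(a, b) \<in> R \<Longrightarrow> (b, a) \<in> R" and trans: "(a, b) \<in> R \<Longrightarrow> (b, c) \<in> R \<Longrightarrow> (a, c) \<in> R" for a b c
      using equiv by (auto simp: equiv_def dest: symD transD)
    have "(xs ! i, xs ! j) \<in> R \<longleftrightarrow> maxset (V i xs) = maxset (V j xs)"
    proof
      assume "(xs ! i, xs ! j) \<in> R"
      moreover have "i \<in> {0, 1, 2} - {j}" "j \<in> {0, 1, 2} - {i}" using ij by auto
      ultimately have "infinite (V i xs)" "infinite (V j xs)"
        using inf[of i xs] inf[of j xs] ij sym by (meson less_trans)+
      then show "maxset (V i xs) = maxset (V j xs)" by (simp add: maxset_infinite)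
    next
      assume eq: "maxset (V i xs) = maxset (V j xs)"
      show "(xs ! i, xs ! j) \<in> R"
      proof (cases "finite (V i xs)")
        case True
        with eq ne have fin: "finite (V j xs)"
          by (metis maxset_finite maxset_infinite PInfty_neq_ereal(1))
        with True eq ne have "Max (V i xs) = Max (V j xs)" by (simp add: maxset_finite)
        moreover have "Max (V i xs) \<in> V i xs" "Max (V j xs) \<in> V j xs"
          using True fin ne by (auto intro: Max_in)
        \<comment> \<open>A common maximum would have both residues \<open>i\<close> and
          \<open>j\<close> modulo 3, so this case is contradictory.\<close>
        ultimately show ?thesis using ij by (simp add: V_def)
      next
        case False
        with eq ne have "infinite (V j xs)"
          by (metis maxset_finite maxset_infinite PInfty_neq_ereal(1))
        with False inf[of i xs] inf[of j xs] ij obtain k l where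
          "k \<in> {0, 1, 2} - {i}" "(xs ! i, xs ! k) \<in> R" "l \<in> {0, 1, 2} - {j}" "(xs ! j, xs ! l) \<in> R"
          by auto
        \<comment> \<open>With three indices, \<open>k \<noteq> j\<close> and
          \<open>l \<noteq> i\<close> leave only the third index for both \<open>k\<close> and
          \<open>l\<close>.\<close>
        moreover from this ij have "k = j \<or> l = i \<or> k = l" by auto
        ultimately show ?thesis using sym trans by blast
      qed
    qed
    then show "(xs ! i, xs ! j) \<in> R \<longleftrightarrow> (f xs ! i, f xs ! j) \<in> Emax_ce"
      by (simp add: Emax_ce_def W)
  qed
qed

section \<open>Failure of 4-ary completeness\<close>

text \<open>The quotient is the number of positive multiples of \<open>c\<close> up to
  \<open>f xs\<close>.\<close>

lemma computable_div:
  assumes "c > 0" "computable k f"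
  shows "computable k (\<lambda>xs. f xs div c)"
proof -
  have "computable (Suc k) (\<lambda>ys. f (drop 1 ys))"
    using computable_drop[OF assms(2), of 1] by simp
  then have "computable k (\<lambda>xs. \<Sum>i<f xs. if c * Suc i \<le> f xs then 1 else 0)"
    by (intro computable_sum computable_if decidable_le computable_mult computable_Suc computable_const
        computable_nth assms) auto
  moreover have "(\<Sum>i<n. if c * Suc i \<le> n then 1 else 0) = n div c" for n
  proof -
    have "(c * Suc i \<le> n) = (i < n div c)" for i
      using less_eq_div_iff_mult_less_eq[OF assms(1), of "Suc i" n] by (simp add: mult.commute Suc_le_eq)
    then have "(\<Sum>i<n. if c * Suc i \<le> n then 1 else 0) =
        (\<Sum>i | i \<in> {..<n} \<and> i < n div c. 1 :: nat)"
      by (simp only: sum.inter_filter[OF finite_lessThan])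
    also have "{i. i \<in> {..<n} \<and> i < n div c} = {..<n div c}"
      by (auto intro: less_le_trans[OF _ div_le_dividend])
    finally show ?thesis by simp
  qed
  ultimately show ?thesis by simp
qed

lemma computable_mod:
  assumes "c > 0" "computable k f"
  shows "computable k (\<lambda>xs. f xs mod c)"
  unfolding minus_div_mult_eq_mod[symmetric]
  by (intro computable_diff computable_mult computable_div computable_const assms)

text \<open>Here \<open>n\<close> is 0 if both sets are empty, and otherwise one more than their
  common finite maximum. For c.e. sets the first conjunct is \<open>\<Sigma>\<^sup>0\<^sub>1\<close>
  and the second \<open>\<Pi>\<^sup>0\<^sub>1\<close>, so existence of \<open>n\<close> is
  \<open>\<Sigma>\<^sup>0\<^sub>2\<close>.\<close>

definition common_top :: "nat set \<Rightarrow> nat set \<Rightarrow> nat \<Rightarrow> bool" where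
  "common_top A B n \<longleftrightarrow> (n = 0 \<or> n - 1 \<in> A \<and> n - 1 \<in> B) \<and> (\<forall>z\<in>A \<union> B. z < n)"

lemma common_top_commute: "common_top A B n = common_top B A n"
  by (auto simp: common_top_def)

lemma common_top_finite:
  assumes "common_top A B n"
  shows "finite A" "finite B"
proof -
  have "A \<subseteq> {..<n}" "B \<subseteq> {..<n}" using assms by (auto simp: common_top_def)
  then show "finite A" "finite B" using finite_subset by blast+
qed

lemma common_top_maxset:
  assumes "common_top A B n"
  shows "maxset A = maxset B"
proof (cases "n = 0")
  case True
  with assms have "A = {}" "B = {}" by (auto simp: common_top_def)
  then show ?thesis by simp
next
  case False
  with assms have "n - 1 \<in> A" "n - 1 \<in> B" and *: "\<And>z. z \<in> A \<union> B \<Longrightarrow> z \<le> n - 1"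
    by (auto simp: common_top_def le_diff_conv2 Suc_le_eq)
  then have "Max A = n - 1" "Max B = n - 1"
    using common_top_finite[OF assms] by (auto intro!: Max_eqI)
  with \<open>n - 1 \<in> A\<close> \<open>n - 1 \<in> B\<close> show ?thesis
    using common_top_finite[OF assms] by (metis empty_iff maxset_finite)
qed

lemma maxset_eq_cases:
  assumes "maxset A = maxset B"
  shows "(\<exists>n. common_top A B n) \<or> infinite A \<and> infinite B"
proof (cases "finite A \<and> finite B")
  case True
  show ?thesis
  proof (cases "A = {} \<or> B = {}")
    case True
    with assms have "A = {}" "B = {}" by (auto simp: maxset_def split: if_splits)
    then have "common_top A B 0" by (simp add: common_top_def)
    then show ?thesis by blast
  next
    case False
    with assms True have "Max A = Max B" by (simp add: maxset_finite)
    with True False have "common_top A B (Suc (Max A))"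
      unfolding common_top_def
      by (metis Max_ge Max_in Un_iff diff_Suc_1 le_imp_less_Suc)
    then show ?thesis by blast
  qed
next
  case False
  with assms show ?thesis by (auto simp: maxset_def split: if_splits)
qed

text \<open>There is no common top iff for all \<open>n\<close> and \<open>t\<close>, either stage
  \<open>t\<close> fails to confirm the first conjunct for \<open>n\<close>, or some element
  \<open>z \<ge> n\<close> is enumerated eventually.\<close>

lemma pi02_no_common_top:
  assumes dec: "decidable 3 (\<lambda>xs. A (xs ! 0) (xs ! 1) (xs ! 2))"
    and mono: "\<And>s t x z. s \<le> t \<Longrightarrow> A s x z \<Longrightarrow> A t x z"
    and U: "\<And>x. U x = {z. \<exists>s. A s x z}"
  shows "pi02 {(x, y). x = y \<or> (x div 2 = y div 2 \<and> \<not> (\<exists>n. common_top (U x) (U y) n))}"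
proof -
  have A: "decidable k (\<lambda>xs. A (s xs) (x xs) (z xs))"
    if "computable k s" "computable k x" "computable k z" for k s x z
    using decidable_comp[of "[s, x, z]" "\<lambda>xs. A (xs ! 0) (xs ! 1) (xs ! 2)" k] dec that
    by (auto simp: numeral_3_eq_3 numeral_2_eq_2)
  \<comment> \<open>The universal argument at position 2 codes the pair \<open>(n, t)\<close>,
    decoded by bounded search; the existential one at position 3 bounds \<open>z\<close> and also
    serves as the stage.\<close>
  define Q where "Q xs \<longleftrightarrow> xs ! 0 = xs ! 1 \<or> xs ! 0 div 2 = xs ! 1 div 2 \<and>
    (\<forall>n<Suc (xs ! 2). \<forall>t<Suc (xs ! 2). \<not> xs ! 2 = prod_encode (n, t) \<or>
      \<not> (n = 0 \<or> A t (xs ! 0) (n - 1) \<and> A t (xs ! 1) (n - 1)) \<or>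
      (\<exists>z<xs ! 3. n \<le> z \<and> (A (xs ! 3) (xs ! 0) z \<or> A (xs ! 3) (xs ! 1) z)))" for xs
  have "decidable 4 Q"
    unfolding Q_def
    by (intro decidable_conj decidable_disj decidable_not decidable_bex decidable_ball decidable_eq
        decidable_le A computable_div computable_Suc computable_diff computable_prod_encode
        computable_const computable_nths) auto
  moreover have "x = y \<or> (x div 2 = y div 2 \<and> \<not> (\<exists>n. common_top (U x) (U y) n)) \<longleftrightarrow>
    (\<forall>a. \<exists>b. Q [x, y, a, b])" for x y
  proof -
    define C where "C n t \<longleftrightarrow> n = 0 \<or> A t x (n - 1) \<and> A t y (n - 1)" for n t
    define G where "G n b \<longleftrightarrow> (\<exists>z<b. n \<le> z \<and> (A b x z \<or> A b y z))" for n b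
    have Q: "Q [x, y, prod_encode (n, t), b] \<longleftrightarrow> x = y \<or> x div 2 = y div 2 \<and> (\<not> C n t \<or> G n b)"
      for n t b
      using le_prod_encode_1[of n t] le_prod_encode_2[of t n]
      by (auto simp: Q_def C_def G_def numeral_2_eq_2 numeral_3_eq_3 less_Suc_eq_le)
    have "(\<forall>a. \<exists>b. Q [x, y, a, b]) \<longleftrightarrow> (\<forall>n t. \<exists>b. Q [x, y, prod_encode (n, t), b])"
      by (metis prod_decode_inverse surj_pair)
    moreover have "common_top (U x) (U y) n \<longleftrightarrow> (\<exists>t. C n t) \<and> (\<forall>b. \<not> G n b)" for n
    proof -
      have "(n = 0 \<or> n - 1 \<in> U x \<and> n - 1 \<in> U y) \<longleftrightarrow> (\<exists>t. C n t)"
        unfolding U C_def by simp (meson mono nle_le)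
      moreover have "(\<forall>z\<in>U x \<union> U y. z < n) \<longleftrightarrow> (\<forall>b. \<not> G n b)" (is "?L \<longleftrightarrow> _")
        unfolding G_def
      proof
        assume R: "\<forall>b. \<not> (\<exists>z<b. n \<le> z \<and> (A b x z \<or> A b y z))"
        show ?L
        proof
          fix z assume "z \<in> U x \<union> U y"
          then obtain s where "A s x z \<or> A s y z" by (auto simp: U)
          then have "A (max s (Suc z)) x z \<or> A (max s (Suc z)) y z"
            using mono[of s "max s (Suc z)"] by auto
          with R show "z < n" by (metis max.cobounded2 not_le Suc_le_eq)
        qed
      qed (auto simp: U not_le)
      ultimately show ?thesis unfolding common_top_def by (rule arg_cong2)
    qed
    ultimately show ?thesis unfolding Q by blast
  qed
  ultimately show ?thesis unfolding pi02_def by blast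
qed

definition block :: "nat \<Rightarrow> nat list" where
  "block e = [4 * e, 4 * e + 1, 4 * e + 2, 4 * e + 3]"

text \<open>The set \<open>U (4 * e + i)\<close> is the \<open>i\<close>-th c.e. set that the \<open>e\<close>-th list of programs assigns to the
  block of \<open>e\<close>.\<close>

definition U :: "nat \<Rightarrow> nat set" where
  "U x = {z. judg 6 (x div 4) (list_encode (block (x div 4))) (prod_encode (x mod 4, z)) \<in> D}"

text \<open>Only \<open>2 * k\<close> and \<open>2 * k + 1\<close> can be related, so each block of
  four consists of two pairs. The disjunct \<open>x = y\<close> secures reflexivity when
  \<open>U x\<close> is finite, where a common top of \<open>U x\<close> with itself exists.\<close>

definition diag :: "(nat \<times> nat) set" where
  "diag = {(x, y). x = y \<or> (x div 2 = y div 2 \<and> \<not> (\<exists>n. common_top (U x) (U y) n))}"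

text \<open>For transitivity: among three numbers with the same half, two have the same parity and
  hence coincide.\<close>

lemma equiv_diag: "equiv UNIV diag"
proof (rule equivI)
  show "sym diag" by (auto simp: diag_def sym_def common_top_commute)
  show "trans diag"
  proof (rule transI)
    fix x y z assume *: "(x, y) \<in> diag" "(y, z) \<in> diag"
    then have "x div 2 = y div 2" "y div 2 = z div 2" by (auto simp: diag_def)
    moreover have "x mod 2 = y mod 2 \<or> y mod 2 = z mod 2 \<or> x mod 2 = z mod 2"
      by (metis not_mod_2_eq_0_eq_1)
    ultimately have "x = y \<or> y = z \<or> x = z" by (metis div_mult_mod_eq)
    with * show "(x, z) \<in> diag" by (auto simp: diag_def)
  qed
qed (auto simp: diag_def refl_on_def)

text \<open>The candidate's index \<open>x div 4\<close> enters only as a number inside the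
  judgement, so the stages approximate \<open>U x\<close> decidably and uniformly in
  \<open>x\<close>.\<close>

lemma pi02_diag: "pi02 diag"
  unfolding diag_def
proof (rule pi02_no_common_top)
  let ?A = "\<lambda>s x z. judg 6 (x div 4) (list_encode (block (x div 4))) (prod_encode (x mod 4, z))
    \<in> stage eval_clauses 7 s"
  show "decidable 3 (\<lambda>xs. ?A (xs ! 0) (xs ! 1) (xs ! 2))"
    unfolding judg_def block_def list_encode.simps
    by (intro decidable_stage computable_prod_encode computable_Suc computable_add computable_mult
        computable_div computable_mod computable_const computable_nth) auto
  show "?A t x z" if "s \<le> t" "?A s x z" for s t x z
    using that stage_mono by blast
  show "U x = {z. \<exists>s. ?A s x z}" for x
    by (auto simp: U_def D_def derivable_iff_stage)
qed

lemma not_creduce_diag: "\<not> creduce 4 diag Emax_ce"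
proof
  assume "creduce 4 diag Emax_ce"
  then obtain f where f: "\<forall>i<4. \<exists>p. \<forall>xs. length xs = 4 \<longrightarrow> eval p xs (f xs ! i)"
    and "\<forall>xs. length xs = 4 \<longrightarrow> length (f xs) = 4 \<and>
      (\<forall>i j. i < j \<and> j < 4 \<longrightarrow> ((xs ! i, xs ! j) \<in> diag \<longleftrightarrow> (f xs ! i, f xs ! j) \<in> Emax_ce))"
    unfolding creduce_def by (elim exE conjE) (rule that)
  then have len: "\<And>xs. length xs = 4 \<Longrightarrow> length (f xs) = 4"
    and red: "\<And>xs i j. length xs = 4 \<Longrightarrow> i < j \<Longrightarrow> j < 4 \<Longrightarrow>
      (xs ! i, xs ! j) \<in> diag \<longleftrightarrow> (f xs ! i, f xs ! j) \<in> Emax_ce"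
    by simp_all
  from f obtain p where p: "\<And>i xs. i < 4 \<Longrightarrow> length xs = 4 \<Longrightarrow> eval (p i) xs (f xs ! i)" by metis
  define ps where "ps = map p [0..<4]"
  \<comment> \<open>The diagonal index: \<open>e\<close> codes programs for the four components of
    \<open>f\<close>, so the sets \<open>U\<close> on \<open>block e\<close> are those that
    \<open>f\<close> itself assigns.\<close>
  define e where "e = list_encode (map code ps)"
  have nth: "block e ! i = 4 * e + i" if "i < 4" for i
    using that by (auto simp: block_def less_Suc_eq numeral_eq_Suc)
  have block: "length (block e) = 4" by (simp add: block_def)
  have U: "U (4 * e + i) = W (f (block e) ! i)" if "i < 4" for i
    using that judg_W_iff[of "f (block e)" ps "block e" i] len[OF block] p[OF _ block]
    by (auto simp: U_def ps_def e_def)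
  have red: "(4 * e + i, 4 * e + j) \<in> diag \<longleftrightarrow> maxset (U (4 * e + i)) = maxset (U (4 * e + j))"
    if "i < j" "j < 4" for i j
    using red[OF block that] that by (simp add: nth U Emax_ce_def)
  \<comment> \<open>A common top would make the maxima equal, so by the reduction the pair would be
    related, which excludes a common top. So there is none, the pair is related, and its equal
    maxima must be infinite.\<close>
  have inf: "infinite (U (4 * e + i))" if "i = 0 \<or> i = 2" for i
  proof -
    have "(4 * e + i) div 2 = (4 * e + Suc i) div 2" using that by presburger
    then have "(4 * e + i, 4 * e + Suc i) \<in> diag \<longleftrightarrow> \<not> (\<exists>n. common_top (U (4 * e + i)) (U (4 * e + Suc i)) n)"
      by (simp add: diag_def)
    moreover have "(4 * e + i, 4 * e + Suc i) \<in> diag \<longleftrightarrow> maxset (U (4 * e + i)) = maxset (U (4 * e + Suc i))"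
      using that by (intro red) auto
    ultimately show ?thesis using common_top_maxset maxset_eq_cases by blast
  qed
  \<comment> \<open>Both maxima are infinite, hence equal, so the reduction relates members of
    different pairs.\<close>
  then have "(4 * e + 0, 4 * e + 2) \<in> diag"
    using red[of 0 2] inf[of 0] inf[of 2] by (simp add: maxset_infinite)
  then show False by (simp add: diag_def)
qed

theorem theorem4p2:
  shows "(\<forall>R. equiv UNIV R \<and> pi02 R \<longrightarrow> creduce 3 R Emax_ce) \<and>
         \<not> (\<forall>R. equiv UNIV R \<and> pi02 R \<longrightarrow> creduce 4 R Emax_ce)"
proof
  show "\<forall>R. equiv UNIV R \<and> pi02 R \<longrightarrow> creduce 3 R Emax_ce"
    by (simp add: ternary_complete)
  show "\<not> (\<forall>R. equiv UNIV R \<and> pi02 R \<longrightarrow> creduce 4 R Emax_ce)"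
    using equiv_diag pi02_diag not_creduce_diag by metis
qed

end
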